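(* Consider the equation $$\ddot x + \gamma \dot x + x^{2p+1} = f(\boldsymbol{\omega} t),$$ where $p\in\mathbb{N}$, $f$ is a quasi-periodic function, analytic in its argument, with non-zero average, and $\boldsymbol{\omega}\in\mathbb{R}^d$ satisfies the Diophantine condition $|\boldsymbol{\omega}\cdot\boldsymbol{\nu}|\ge C_0|\boldsymbol{\nu}|^{-\tau}$ for all $\boldsymbol{\nu}\in\mathbb{Z}^d\setminus\{\boldsymbol 0\}$. There exists $\gamma_0>0$ such that for all real $\gamma>\gamma_0$ there is a unique quasi-periodic solution $x_0(t)$ with the same frequency vector $\boldsymbol{\omega}$ as the forcing term. Such a solution describes a limit cycle in the plane $(x,\dot x)$ which is a global attractor.
   Context: $\gamma>0$ is a real parameter (dissipation coefficient). $f(\boldsymbol{\psi})=\sum_{\boldsymbol{\nu}\in\mathbb{Z}^d}e^{i\boldsymbol{\nu}\cdot\boldsymbol{\psi}}f_{\boldsymbol{\nu}}$ is real-valued and analytic: there are constants $F,\xi>0$ with $|f_{\boldsymbol{\nu}}|\le F e^{-\xi|\boldsymbol{\nu}|}$ for all $\boldsymbol{\nu}\in\mathbb{Z}^d$; its average is $f_{\boldsymbol 0}$. Here $|\boldsymbol{\nu}|=|\nu_1|+\dots+|\nu_d|$, and $C_0>0$, $\tau>d-1$ are constants with $C_0$ small enough (for $d=1$ the condition is automatic). A quasi-periodic solution with frequency vector $\boldsymbol{\omega}$ is a solution of the form $X(\boldsymbol{\omega}t)$ with $X(\boldsymbol\psi)$ $2\pi$-periodic in each component of $\boldsymbol\psi\in\mathbb{R}^d$.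 The limit cycle described by $x_0$ being a global attractor means that every solution $x(t)$ of the equation satisfies $(x(t)-x_0(t),\dot x(t)-\dot x_0(t))\to(0,0)$ as $t\to\infty$. *)

theory Defs
  imports "HOL-Analysis.Analysis"
begin

text \<open>The dimension is \<open>d = CARD('d)\<close>; frequency indices are vectors of type \<open>int ^ 'd\<close>.\<close>

definition idx_norm :: "int ^ 'd \<Rightarrow> real"
  where "idx_norm \<nu> = real_of_int (\<Sum>i\<in>UNIV. \<bar>\<nu> $ i\<bar>)"

definition idx_dot :: "real ^ 'd \<Rightarrow> int ^ 'd \<Rightarrow> real"
  where "idx_dot \<psi> \<nu> = (\<Sum>i\<in>UNIV. \<psi> $ i * real_of_int (\<nu> $ i))"

definition diophantine :: "real \<Rightarrow> real \<Rightarrow> real ^ 'd \<Rightarrow> bool"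
  where "diophantine C0 \<tau> \<omega> \<longleftrightarrow>
    (\<forall>\<nu> :: int ^ 'd. \<nu> \<noteq> 0 \<longrightarrow> \<bar>idx_dot \<omega> \<nu>\<bar> \<ge> C0 * idx_norm \<nu> powr (- \<tau>))"

text \<open>\<open>c\<close> is the family of Fourier coefficients of the real-valued function \<open>f\<close>; in particular
  \<open>c 0\<close> is the average of \<open>f\<close>. Exponential decay of \<open>c\<close> encodes analyticity of \<open>f\<close>.\<close>

definition analytic_fourier :: "(real ^ 'd \<Rightarrow> real) \<Rightarrow> (int ^ 'd \<Rightarrow> complex) \<Rightarrow> bool"
  where "analytic_fourier f c \<longleftrightarrow>
    (\<exists>F>0. \<exists>\<xi>>0. \<forall>\<nu>. norm (c \<nu>) \<le> F * exp (- \<xi> * idx_norm \<nu>)) \<and>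
    (\<forall>\<psi>. ((\<lambda>\<nu>. exp (\<i> * complex_of_real (idx_dot \<psi> \<nu>)) * c \<nu>) has_sum complex_of_real (f \<psi>)) UNIV)"

text \<open>Only used for open \<open>I\<close>, so that \<^const>\<open>deriv\<close> is the ordinary two-sided derivative on \<open>I\<close>.\<close>

definition solution_on ::
    "real set \<Rightarrow> nat \<Rightarrow> real \<Rightarrow> (real ^ 'd \<Rightarrow> real) \<Rightarrow> real ^ 'd \<Rightarrow> (real \<Rightarrow> real) \<Rightarrow> bool"
  where "solution_on I p \<gamma> f \<omega> x \<longleftrightarrow>
    (\<forall>t\<in>I. x differentiable (at t) \<and> deriv x differentiable (at t) \<and>
      deriv (deriv x) t + \<gamma> * deriv x t + x t ^ (2 * p + 1) = f (t *\<^sub>R \<omega>))"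

text \<open>Continuity of \<open>X\<close> is essential: if the components of \<open>\<omega>\<close> are rationally independent and
  \<open>d \<ge> 2\<close>, then \<open>t \<mapsto> t \<omega>\<close> is injective modulo \<open>2\<pi>\<int>\<^sup>d\<close>, so with arbitrary \<open>X\<close> every function of \<open>t\<close>
  would be quasi-periodic.\<close>

definition quasi_periodic :: "real ^ 'd \<Rightarrow> (real \<Rightarrow> real) \<Rightarrow> bool"
  where "quasi_periodic \<omega> x \<longleftrightarrow>
    (\<exists>X :: real ^ 'd \<Rightarrow> real. continuous_on UNIV X \<and>
      (\<forall>\<psi> i. X (\<psi> + axis i (2 * pi)) = X \<psi>) \<and> (\<forall>t. x t = X (t *\<^sub>R \<omega>)))"

definition quasi_periodic_solution ::
    "nat \<Rightarrow> real \<Rightarrow> (real ^ 'd \<Rightarrow> real) \<Rightarrow> real ^ 'd \<Rightarrow> (real \<Rightarrow> real) \<Rightarrow> bool"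
  where "quasi_periodic_solution p \<gamma> f \<omega> x \<longleftrightarrow>
    solution_on UNIV p \<gamma> f \<omega> x \<and> quasi_periodic \<omega> x"

text \<open>Solutions competing with \<open>x0\<close> need only be defined on some half-line \<open>(t0, \<infinity>)\<close>.\<close>

definition global_attractor ::
    "nat \<Rightarrow> real \<Rightarrow> (real ^ 'd \<Rightarrow> real) \<Rightarrow> real ^ 'd \<Rightarrow> (real \<Rightarrow> real) \<Rightarrow> bool"
  where "global_attractor p \<gamma> f \<omega> x0 \<longleftrightarrow>
    (\<forall>t0 x. solution_on {t0<..} p \<gamma> f \<omega> x \<longrightarrow>
      ((\<lambda>t. (x t - x0 t, deriv x t - deriv x0 t)) \<longlongrightarrow> (0, 0)) at_top)"

end

theory Submission
  imports Defs "HOL-Probability.Distributions"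
begin

text \<open>
Write \<open>n = 2p + 1\<close>, let \<open>f\<^sub>0 \<noteq> 0\<close> be the average of the forcing and let \<open>a\<close> be the real number with
\<open>a\<^sup>n = f\<^sub>0\<close>. Strong damping makes the motion slow, so the oscillating part of the forcing averages
out and the solution should settle close to the constant \<open>a\<close>.

\<^emph>\<open>Existence.\<close> For \<open>\<kappa> > 0\<close> and large \<open>\<gamma>\<close> the operator \<open>x'' + \<gamma> x' + \<kappa> x\<close> is overdamped: it
factors as \<open>(d/dt + \<mu>\<^sub>1)(d/dt + \<mu>\<^sub>2)\<close> with \<open>\<mu>\<^sub>1, \<mu>\<^sub>2 > 0\<close>, and its bounded inverse is
\<open>\<kappa>\<^sup>-\<^sup>1 J\<^sub>2 J\<^sub>1\<close>, where \<open>J\<^sub>i\<close> averages a function over its past with exponential weights of rate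
\<open>\<mu>\<^sub>i\<close>. A solution \<open>X(\<omega> t)\<close> is therefore given by each fixed point \<open>X\<close> of
\<open>X \<mapsto> \<kappa>\<^sup>-\<^sup>1 J\<^sub>2 J\<^sub>1 (f + \<kappa> X - X\<^sup>n)\<close> among the continuous functions on the torus. Take \<open>\<kappa>\<close> to be the
largest slope of \<open>x\<^sup>n\<close> for \<open>x\<close> within \<open>\<bar>a\<bar>/2\<close> of \<open>a\<close>. Since averages preserve bounds, the map
contracts the functions with values in this interval by a factor that does not depend on \<open>\<gamma>\<close>.
It moves the constant function \<open>a\<close> by \<open>\<kappa>\<^sup>-\<^sup>1 J\<^sub>2 J\<^sub>1 (f - f\<^sub>0)\<close>, and this tends to \<open>0\<close> as \<open>\<gamma> \<rightarrow> \<infinity>\<close>: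
because \<open>\<omega> \<cdot> \<nu> \<noteq> 0\<close> for \<open>\<nu> \<noteq> 0\<close>, the function \<open>f - f\<^sub>0\<close> is, up to a uniformly small remainder, a
partial Fourier sum with a bounded primitive along the flow \<open>t \<mapsto> \<psi> + t \<omega>\<close>, and for such a sum
integration by parts wins a factor \<open>1/\<mu>\<^sub>2 \<le> 2/\<gamma>\<close>. Hence the fixed point theorem of Banach applies
(\<open>averaged_fixed_point\<close>, \<open>eventually_bounded_response\<close>). The solution \<open>x\<^sub>0\<close> found in this way
stays at distance at least \<open>\<bar>a\<bar>/2\<close> from \<open>0\<close>, and \<open>x\<^sub>0'\<close> is of order \<open>1/\<gamma>\<close>.

\<^emph>\<open>Attraction.\<close> For another solution \<open>x\<close> put \<open>u = x - x\<^sub>0\<close> and \<open>h = x\<^sup>n - x\<^sub>0\<^sup>n\<close>. The function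
\<open>L = u'\<^sup>2/4 + (u' + \<gamma> u)\<^sup>2/4 + V\<close>, where \<open>V\<close> is the excess of \<open>x\<^sup>n\<^sup>+\<^sup>1/(n+1)\<close> over its tangent at
\<open>x\<^sub>0\<close>, has derivative \<open>- (\<gamma>/2) u'\<^sup>2 - (\<gamma>/2) h u + x\<^sub>0' (h - n x\<^sub>0\<^sup>n\<^sup>-\<^sup>1 u)\<close>. The last term is at most
half of the second one when \<open>x\<^sub>0'\<close> is small and \<open>x\<^sub>0\<close> is away from \<open>0\<close>, whatever the size of \<open>u\<close>.
So \<open>L\<close> decays exponentially and no a priori bound on \<open>x\<close> is required (\<open>slow_solution_attracts\<close>).

\<^emph>\<open>Uniqueness.\<close> The difference of two quasi-periodic solutions is \<open>Z(\<omega> t)\<close> with \<open>Z\<close> continuous and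
periodic, and it tends to \<open>0\<close>. The flow returns arbitrarily late and arbitrarily close to its starting
point, so \<open>Z(\<omega> t)\<close> vanishes identically (\<open>quasi_periodic_tendsto_0\<close>).
\<close>

section \<open>Inequalities for odd powers\<close>

text \<open>The right side minus the left side is \<open>(a\<^sup>2 - b\<^sup>2)(a\<^sup>2\<^sup>p - b\<^sup>2\<^sup>p)\<close>, which is nonnegative by
monotonicity. The bound makes \<open>x\<^sup>n\<close> strictly monotone, uniformly in \<open>a\<close>, once \<open>b\<close> is away from \<open>0\<close>.\<close>

lemma odd_power_gap:
  fixes a b :: real
  shows "(a ^ (2 * p) + b ^ (2 * p)) * (a - b)\<^sup>2
    \<le> 2 * ((a ^ (2 * p + 1) - b ^ (2 * p + 1)) * (a - b))"
proof -
  have "0 \<le> (a\<^sup>2 - b\<^sup>2) * ((a\<^sup>2) ^ p - (b\<^sup>2) ^ p)"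
  proof (cases "a\<^sup>2 \<le> b\<^sup>2")
    case True
    then have "(a\<^sup>2) ^ p \<le> (b\<^sup>2) ^ p" by (rule power_mono) simp
    with True show ?thesis by (intro mult_nonpos_nonpos) auto
  next
    case False
    then have "(b\<^sup>2) ^ p \<le> (a\<^sup>2) ^ p" by (intro power_mono[of "b\<^sup>2"]) auto
    with False show ?thesis by (intro mult_nonneg_nonneg) auto
  qed
  also have "\<dots> = 2 * ((a ^ (2 * p + 1) - b ^ (2 * p + 1)) * (a - b))
      - (a ^ (2 * p) + b ^ (2 * p)) * (a - b)\<^sup>2"
    by (simp add: power_mult algebra_simps power2_eq_square)
  finally show ?thesis by simp
qed

text \<open>Bernoulli's inequality, rescaled from base point \<open>1\<close> to base point \<open>b\<close>.\<close>

lemma even_power_above_tangent: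
  fixes y b :: real
  shows "real (2 * p + 2) * b ^ (2 * p + 1) * (y - b) \<le> y ^ (2 * p + 2) - b ^ (2 * p + 2)"
proof (cases "b = 0")
  case False
  have "b ^ (2 * p + 2) * (1 + real (2 * p + 2) * (y / b - 1))
      \<le> b ^ (2 * p + 2) * (1 + (y / b - 1)) ^ (2 * p + 2)"
    by (intro mult_left_mono Bernoulli_inequality_even zero_le_even_power) auto
  moreover have "b ^ (2 * p + 2) * (1 + (y / b - 1)) ^ (2 * p + 2) = y ^ (2 * p + 2)"
    using False by (simp add: power_divide)
  moreover have "b ^ (2 * p + 2) * (1 + real (2 * p + 2) * (y / b - 1))
      = b ^ (2 * p + 2) + real (2 * p + 2) * b ^ (2 * p + 1) * (y - b)"
    using False by (simp add: field_simps)
  ultimately show ?thesis by linarith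
next
  case True
  have "0 \<le> y ^ (2 * p + 2)" by (intro zero_le_even_power) auto
  with True show ?thesis by simp
qed

text \<open>The Lipschitz bound for \<open>x\<^sup>k\<close> on \<open>[-M, M]\<close>; both sides carry an additional factor \<open>M\<close> so that the
exponent \<open>k - 1\<close> does not occur and the induction can start at \<open>0\<close>. The next lemma uses the same device,
with a further factor \<open>b\<close>, for the second-order Taylor remainder.\<close>

lemma power_diff_le:
  fixes a b M :: real
  assumes "\<bar>a\<bar> \<le> M" "\<bar>b\<bar> \<le> M"
  shows "M * \<bar>a ^ k - b ^ k\<bar> \<le> real k * M ^ k * \<bar>a - b\<bar>"
proof (induction k)
  case (Suc k)
  have M: "0 \<le> M" using assms by linarith
  have "a ^ Suc k - b ^ Suc k = a * (a ^ k - b ^ k) + b ^ k * (a - b)"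
    by (simp add: algebra_simps)
  then have "M * \<bar>a ^ Suc k - b ^ Suc k\<bar> \<le> M * (\<bar>a\<bar> * \<bar>a ^ k - b ^ k\<bar> + \<bar>b\<bar> ^ k * \<bar>a - b\<bar>)"
    using M by (metis abs_mult abs_triangle_ineq mult_left_mono power_abs)
  also have "\<dots> = \<bar>a\<bar> * (M * \<bar>a ^ k - b ^ k\<bar>) + M * (\<bar>b\<bar> ^ k * \<bar>a - b\<bar>)"
    by (simp add: algebra_simps)
  also have "\<dots> \<le> M * (real k * M ^ k * \<bar>a - b\<bar>) + M * (M ^ k * \<bar>a - b\<bar>)"
    by (intro add_mono mult_mono[OF assms(1) Suc] mult_left_mono mult_right_mono power_mono)
      (use assms M in auto)
  finally show ?case by (simp add: algebra_simps)
qed simp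

lemma power_Taylor_remainder_le:
  fixes a b M :: real
  assumes "\<bar>a\<bar> \<le> M" "\<bar>b\<bar> \<le> M"
  shows "M * \<bar>b * (a ^ k - b ^ k) - real k * b ^ k * (a - b)\<bar> \<le> real k ^ 2 * M ^ k * (a - b)\<^sup>2"
proof (induction k)
  case (Suc k)
  have M: "0 \<le> M" using assms by linarith
  let ?e = "b * (a ^ k - b ^ k) - real k * b ^ k * (a - b)"
  have "b * (a ^ Suc k - b ^ Suc k) - real (Suc k) * b ^ Suc k * (a - b)
      = b * ?e + b * (a - b) * (a ^ k - b ^ k)"
    by (simp add: algebra_simps)
  then have "M * \<bar>b * (a ^ Suc k - b ^ Suc k) - real (Suc k) * b ^ Suc k * (a - b)\<bar>
      \<le> M * (\<bar>b\<bar> * \<bar>?e\<bar> + \<bar>b\<bar> * \<bar>a - b\<bar> * \<bar>a ^ k - b ^ k\<bar>)"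
    using M by (metis abs_mult abs_triangle_ineq mult_left_mono)
  also have "\<dots> = \<bar>b\<bar> * (M * \<bar>?e\<bar>) + \<bar>b\<bar> * \<bar>a - b\<bar> * (M * \<bar>a ^ k - b ^ k\<bar>)"
    by (simp add: algebra_simps)
  also have "\<dots> \<le> M * (real k ^ 2 * M ^ k * (a - b)\<^sup>2) + M * \<bar>a - b\<bar> * (real k * M ^ k * \<bar>a - b\<bar>)"
    by (intro add_mono mult_mono[OF assms(2) Suc] mult_mono[OF _ power_diff_le[OF assms, of k]]
        mult_right_mono) (use assms M in auto)
  also have "M * \<bar>a - b\<bar> * (real k * M ^ k * \<bar>a - b\<bar>) = real k * M ^ Suc k * (\<bar>a - b\<bar> * \<bar>a - b\<bar>)"
    by (simp only: power_Suc mult_ac)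
  also have "\<dots> = real k * M ^ Suc k * (a - b)\<^sup>2"
    by (simp only: abs_mult_self_eq power2_eq_square)
  also have "M * (real k ^ 2 * M ^ k * (a - b)\<^sup>2) + \<dots> = (real k ^ 2 + real k) * (M ^ Suc k * (a - b)\<^sup>2)"
    by (simp add: algebra_simps)
  also have "\<dots> \<le> real (Suc k) ^ 2 * (M ^ Suc k * (a - b)\<^sup>2)"
  proof (rule mult_right_mono)
    show "real k ^ 2 + real k \<le> real (Suc k) ^ 2" by (simp add: power2_eq_square algebra_simps)
    show "0 \<le> M ^ Suc k * (a - b)\<^sup>2" using M by simp
  qed
  finally show ?case by (simp add: algebra_simps)
qed simp

text \<open>The quadratic error of linearizing \<open>x\<^sup>n\<close> at \<open>b\<close> is of size \<open>max(\<bar>a\<bar>,\<bar>b\<bar>)\<^sup>2\<^sup>p (a - b)\<^sup>2\<close> after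
multiplication by \<open>\<bar>b\<bar>\<close>, and \<open>odd_power_gap\<close> bounds exactly this quantity by the monotonicity term. As
both sides are homogeneous of the same degree, the estimate holds for all \<open>a\<close>, however large; this is
what makes the attraction global.\<close>

lemma odd_power_linearization_error:
  fixes a b :: real
  shows "\<bar>b\<bar> * \<bar>a ^ (2 * p + 1) - b ^ (2 * p + 1) - real (2 * p + 1) * b ^ (2 * p) * (a - b)\<bar>
    \<le> 2 * real (2 * p + 1) ^ 2 * ((a ^ (2 * p + 1) - b ^ (2 * p + 1)) * (a - b))"
proof -
  define M where "M = max \<bar>a\<bar> \<bar>b\<bar>"
  let ?e = "b * (a ^ (2 * p + 1) - b ^ (2 * p + 1)) - real (2 * p + 1) * b ^ (2 * p + 1) * (a - b)"
  have M2: "M ^ (2 * p) \<le> a ^ (2 * p) + b ^ (2 * p)"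
    by (auto simp: M_def max_def power_even_abs)
  have "\<bar>?e\<bar> \<le> real (2 * p + 1) ^ 2 * M ^ (2 * p) * (a - b)\<^sup>2"
  proof (cases "M = 0")
    case True
    then have "a = 0" "b = 0" by (auto simp: M_def max_def split: if_splits)
    then show ?thesis by simp
  next
    case False
    then have "0 < M" by (auto simp: M_def max_def split: if_splits)
    moreover have "M * \<bar>?e\<bar> \<le> M * (real (2 * p + 1) ^ 2 * M ^ (2 * p) * (a - b)\<^sup>2)"
      using power_Taylor_remainder_le[of a M b "2 * p + 1"] by (simp add: M_def algebra_simps)
    ultimately show ?thesis by (simp only: mult_le_cancel_left_pos)
  qed
  also have "\<dots> \<le> real (2 * p + 1) ^ 2 * ((a ^ (2 * p) + b ^ (2 * p)) * (a - b)\<^sup>2)"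
    unfolding mult.assoc using M2 by (intro mult_left_mono mult_right_mono) auto
  also have "\<dots> \<le> real (2 * p + 1) ^ 2 * (2 * ((a ^ (2 * p + 1) - b ^ (2 * p + 1)) * (a - b)))"
    by (intro mult_left_mono odd_power_gap) auto
  also have "\<bar>?e\<bar> = \<bar>b\<bar> * \<bar>a ^ (2 * p + 1) - b ^ (2 * p + 1) - real (2 * p + 1) * b ^ (2 * p) * (a - b)\<bar>"
    unfolding abs_mult[symmetric] by (rule arg_cong[where f = abs]) (simp add: algebra_simps)
  finally show ?thesis by (simp only: mult_ac)
qed

text \<open>The mean value theorem: between \<open>a - \<bar>a\<bar>/2\<close> and \<open>a + \<bar>a\<bar>/2\<close> the modulus of the argument stays between
\<open>\<bar>a\<bar>/2\<close> and \<open>3\<bar>a\<bar>/2\<close>, whatever the sign of \<open>a\<close>.\<close>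

lemma odd_power_increment:
  fixes a x y :: real
  assumes "x \<le> y" "\<bar>x - a\<bar> \<le> \<bar>a\<bar> / 2" "\<bar>y - a\<bar> \<le> \<bar>a\<bar> / 2"
  shows "real (2 * p + 1) * (\<bar>a\<bar> / 2) ^ (2 * p) * (y - x) \<le> y ^ (2 * p + 1) - x ^ (2 * p + 1)"
    and "y ^ (2 * p + 1) - x ^ (2 * p + 1) \<le> real (2 * p + 1) * (3 * \<bar>a\<bar> / 2) ^ (2 * p) * (y - x)"
proof -
  have "real (2 * p + 1) * (\<bar>a\<bar> / 2) ^ (2 * p) * (y - x) \<le> y ^ (2 * p + 1) - x ^ (2 * p + 1)
    \<and> y ^ (2 * p + 1) - x ^ (2 * p + 1) \<le> real (2 * p + 1) * (3 * \<bar>a\<bar> / 2) ^ (2 * p) * (y - x)"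
  proof (cases "x = y")
    case False
    have d: "((\<lambda>x. x ^ (2 * p + 1)) has_real_derivative real (2 * p + 1) * z ^ (2 * p)) (at z)" for z :: real
      using DERIV_pow[of "2 * p + 1" z UNIV] by simp
    from False have "x < y" using assms by simp
    then have "\<exists>z. x < z \<and> z < y \<and> y ^ (2 * p + 1) - x ^ (2 * p + 1) = (y - x) * (real (2 * p + 1) * z ^ (2 * p))"
      by (intro MVT2 d)
    then obtain z where z: "x < z" "z < y"
      "y ^ (2 * p + 1) - x ^ (2 * p + 1) = (y - x) * (real (2 * p + 1) * z ^ (2 * p))" by auto
    have "\<bar>a\<bar> / 2 \<le> \<bar>z\<bar>" "\<bar>z\<bar> \<le> 3 * \<bar>a\<bar> / 2" using z(1,2) assms by linarith+
    then have "(\<bar>a\<bar> / 2) ^ (2 * p) \<le> \<bar>z\<bar> ^ (2 * p)" "\<bar>z\<bar> ^ (2 * p) \<le> (3 * \<bar>a\<bar> / 2) ^ (2 * p)"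
      by (intro power_mono; simp)+
    then have "(\<bar>a\<bar> / 2) ^ (2 * p) \<le> z ^ (2 * p)" "z ^ (2 * p) \<le> (3 * \<bar>a\<bar> / 2) ^ (2 * p)"
      by (simp_all add: power_even_abs)
    then show ?thesis
      unfolding z(3) using \<open>x < y\<close> by (auto simp: mult.commute[of "y - x"] intro!: mult_left_mono mult_right_mono)
  qed simp
  then show "real (2 * p + 1) * (\<bar>a\<bar> / 2) ^ (2 * p) * (y - x) \<le> y ^ (2 * p + 1) - x ^ (2 * p + 1)"
    and "y ^ (2 * p + 1) - x ^ (2 * p + 1) \<le> real (2 * p + 1) * (3 * \<bar>a\<bar> / 2) ^ (2 * p) * (y - x)"
    by auto
qed

text \<open>With \<open>\<kappa>\<close> the largest slope of \<open>x\<^sup>n\<close> near \<open>a\<close>, the map \<open>x \<mapsto> \<kappa> x - x\<^sup>n\<close> is nondecreasing there, and its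
Lipschitz constant is smaller than \<open>\<kappa>\<close> by the smallest slope.\<close>

lemma odd_power_contraction:
  fixes a x y :: real and p :: nat
  defines "\<kappa> \<equiv> real (2 * p + 1) * (3 * \<bar>a\<bar> / 2) ^ (2 * p)"
  assumes "\<bar>x - a\<bar> \<le> \<bar>a\<bar> / 2" "\<bar>y - a\<bar> \<le> \<bar>a\<bar> / 2"
  shows "\<bar>(\<kappa> * x - x ^ (2 * p + 1)) - (\<kappa> * y - y ^ (2 * p + 1))\<bar>
    \<le> (\<kappa> - real (2 * p + 1) * (\<bar>a\<bar> / 2) ^ (2 * p)) * \<bar>x - y\<bar>"
proof -
  have *: "\<bar>(\<kappa> * x - x ^ (2 * p + 1)) - (\<kappa> * y - y ^ (2 * p + 1))\<bar>
      \<le> (\<kappa> - real (2 * p + 1) * (\<bar>a\<bar> / 2) ^ (2 * p)) * (y - x)"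
    if "x \<le> y" "\<bar>x - a\<bar> \<le> \<bar>a\<bar> / 2" "\<bar>y - a\<bar> \<le> \<bar>a\<bar> / 2" for x y
    using odd_power_increment[OF that, of p]
    unfolding \<kappa>_def[symmetric] left_diff_distrib right_diff_distrib abs_le_iff by linarith
  show ?thesis
  proof (cases "x \<le> y")
    case True
    then show ?thesis using *[OF True assms(2,3)] by (simp add: abs_minus_commute[of x y])
  next
    case False
    then have "y \<le> x" by simp
    then show ?thesis using *[OF \<open>y \<le> x\<close> assms(3,2)] by (subst abs_minus_commute) simp
  qed
qed

section \<open>Bounded solutions of first-order linear equations\<close>

text \<open>If \<open>v\<close> exceeded \<open>B/\<mu>\<close> at some time, then \<open>(v - B/\<mu>) e\<^sup>\<mu>\<^sup>t\<close>, which is nonincreasing, would stay above a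
positive constant in the past. This is impossible for bounded \<open>v\<close>, because the exponential vanishes at
\<open>-\<infinity>\<close>.\<close>

lemma bounded_solution_upper:
  fixes v :: "real \<Rightarrow> real"
  assumes \<mu>: "\<mu> > 0"
    and v: "\<And>t. (v has_real_derivative d t) (at t)"
    and le: "\<And>t. d t + \<mu> * v t \<le> B"
    and bdd: "\<And>t. \<bar>v t\<bar> \<le> C"
  shows "v t \<le> B / \<mu>"
proof (rule ccontr)
  assume "\<not> v t \<le> B / \<mu>"
  then have gt: "v t > B / \<mu>" by simp
  define q where "q s = (v s - B / \<mu>) * exp (\<mu> * s)" for s
  have mono: "q t \<le> q s" if "s \<le> t" for s
  proof (rule DERIV_nonpos_imp_nonincreasing[OF that])
    fix x
    have "(q has_real_derivative (d x + \<mu> * v x - B) * exp (\<mu> * x)) (at x)"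
      unfolding q_def using \<mu> by (auto intro!: derivative_eq_intros v simp: field_simps)
    moreover have "(d x + \<mu> * v x - B) * exp (\<mu> * x) \<le> 0"
      using le[of x] by (simp add: mult_nonpos_nonneg)
    ultimately show "\<exists>y. (q has_real_derivative y) (at x) \<and> y \<le> 0" by blast
  qed
  have "((\<lambda>s. (C + \<bar>B / \<mu>\<bar>) * exp (\<mu> * s)) \<longlongrightarrow> (C + \<bar>B / \<mu>\<bar>) * 0) at_bot"
    using \<mu> by (intro tendsto_intros filterlim_compose[OF exp_at_bot]
        filterlim_tendsto_pos_mult_at_bot[OF tendsto_const] filterlim_ident) auto
  moreover have "q t > 0" using gt by (simp add: q_def)
  ultimately have "eventually (\<lambda>s. (C + \<bar>B / \<mu>\<bar>) * exp (\<mu> * s) < q t) at_bot"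
    by (intro order_tendstoD) auto
  then obtain s where s: "s \<le> t" "(C + \<bar>B / \<mu>\<bar>) * exp (\<mu> * s) < q t"
    unfolding eventually_at_bot_linorder by (meson linear order_trans)
  have "q s \<le> (C + \<bar>B / \<mu>\<bar>) * exp (\<mu> * s)"
    unfolding q_def using bdd[of s] by (intro mult_right_mono) (auto simp: abs_if split: if_splits)
  with mono[OF s(1)] s(2) show False by linarith
qed

text \<open>For \<open>B = 0\<close> this says that a solution of \<open>v' = -\<mu> v\<close> that is bounded on the whole line vanishes.\<close>

lemma bounded_solution_bound:
  fixes v :: "real \<Rightarrow> real"
  assumes \<mu>: "\<mu> > 0"
    and v: "\<And>t. (v has_real_derivative d t) (at t)"
    and le: "\<And>t. \<bar>d t + \<mu> * v t\<bar> \<le> B"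
    and bdd: "\<And>t. \<bar>v t\<bar> \<le> C"
  shows "\<bar>v t\<bar> \<le> B / \<mu>"
proof -
  have "v t \<le> B / \<mu>"
    using le by (intro bounded_solution_upper[OF \<mu> v _ bdd]) (simp add: abs_le_iff)
  moreover have "- v t \<le> B / \<mu>"
  proof (rule bounded_solution_upper[OF \<mu>, of "\<lambda>t. - v t" "\<lambda>t. - d t"])
    show "((\<lambda>t. - v t) has_real_derivative - d t) (at t)" for t
      by (intro DERIV_minus v)
    show "- d t + \<mu> * - v t \<le> B" for t using le[of t] by (simp add: abs_le_iff)
    show "\<bar>- v t\<bar> \<le> C" for t using bdd[of t] by simp
  qed
  ultimately show ?thesis by (simp add: abs_le_iff)
qed

section \<open>Exponentially weighted averages along a linear flow\<close>

lemma real_bcontfun_iff: "h \<in> bcontfun \<longleftrightarrow> continuous_on UNIV h \<and> (\<exists>B. \<forall>x. \<bar>h x :: real\<bar> \<le> B)"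
  by (auto simp: bcontfun_def bounded_iff)

lemma bcontfun_compose:
  fixes h :: "'a :: topological_space \<Rightarrow> real" and g :: "real \<Rightarrow> real"
  assumes "h \<in> bcontfun" "continuous_on UNIV g"
  shows "(\<lambda>x. g (h x)) \<in> bcontfun"
proof -
  from assms(1) have "continuous_on UNIV h" and bdd: "bounded (range h)"
    by (auto simp: bcontfun_def)
  then have "continuous_on UNIV (\<lambda>x. g (h x))"
    using assms(2) by (auto intro: continuous_on_compose2)
  moreover have "bounded (range (\<lambda>x. g (h x)))"
  proof -
    have "compact (g ` closure (range h))"
      using bdd by (intro compact_continuous_image continuous_on_subset[OF assms(2)]) auto
    then have "bounded (g ` closure (range h))" by (rule compact_imp_bounded)
    moreover have "range (\<lambda>x. g (h x)) \<subseteq> g ` closure (range h)"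
      using closure_subset by fastforce
    ultimately show ?thesis by (rule bounded_subset)
  qed
  ultimately show ?thesis by (simp add: bcontfun_def)
qed

text \<open>The mean of \<open>h\<close> over the past of \<open>\<psi>\<close> under the flow of \<open>\<omega>\<close>, at an exponentially distributed time. For
\<open>\<mu> > 0\<close> it is \<open>\<mu> (\<mu> + \<partial>\<^sub>\<omega>)\<^sup>-\<^sup>1 h\<close>, where \<open>\<partial>\<^sub>\<omega>\<close> is the derivative along the flow. Normalizing the resolvent
to a probability average makes it preserve bounds and constants.\<close>

definition exp_average :: "real \<Rightarrow> 'a :: real_normed_vector \<Rightarrow> ('a \<Rightarrow> real) \<Rightarrow> 'a \<Rightarrow> real"
  where "exp_average \<mu> \<omega> h \<psi> = (\<integral>s. h (\<psi> - s *\<^sub>R \<omega>) \<partial>density lborel (exponential_density \<mu>))"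

lemma exp_average_integrable:
  fixes h :: "'a :: real_normed_vector \<Rightarrow> real"
  assumes "\<mu> > 0" "h \<in> bcontfun"
  shows "integrable (density lborel (exponential_density \<mu>)) (\<lambda>s. h (\<psi> - s *\<^sub>R \<omega>))"
proof -
  interpret prob_space "density lborel (exponential_density \<mu>)"
    using assms(1) by (rule prob_space_exponential_density)
  obtain B where B: "\<And>x. \<bar>h x\<bar> \<le> B" and h: "continuous_on UNIV h"
    using assms by (auto simp: real_bcontfun_iff)
  show ?thesis
  proof (rule integrable_const_bound[where B = B])
    have "continuous_on UNIV (\<lambda>s. h (\<psi> - s *\<^sub>R \<omega>))"
      by (intro continuous_on_compose2[OF h] continuous_intros) auto
    then show "(\<lambda>s. h (\<psi> - s *\<^sub>R \<omega>)) \<in> borel_measurable (density lborel (exponential_density \<mu>))"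
      using borel_measurable_continuous_onI by simp
  qed (use B in auto)
qed

lemma exp_average_mono:
  fixes h k :: "'a :: real_normed_vector \<Rightarrow> real"
  assumes "\<mu> > 0" "h \<in> bcontfun" "k \<in> bcontfun" "\<And>x. h x \<le> k x"
  shows "exp_average \<mu> \<omega> h \<psi> \<le> exp_average \<mu> \<omega> k \<psi>"
  unfolding exp_average_def using assms by (intro integral_mono exp_average_integrable) auto

lemma exp_average_const:
  assumes \<mu>: "\<mu> > 0"
  shows "exp_average \<mu> \<omega> (\<lambda>_. c) \<psi> = c"
proof -
  interpret prob_space "density lborel (exponential_density \<mu>)"
    using \<mu> by (rule prob_space_exponential_density)
  show ?thesis using prob_space by (simp add: exp_average_def)
qed

lemma exp_average_add:
  fixes h k :: "'a :: real_normed_vector \<Rightarrow> real"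
  assumes "\<mu> > 0" "h \<in> bcontfun" "k \<in> bcontfun"
  shows "exp_average \<mu> \<omega> (\<lambda>x. h x + k x) \<psi> = exp_average \<mu> \<omega> h \<psi> + exp_average \<mu> \<omega> k \<psi>"
  unfolding exp_average_def using assms by (intro Bochner_Integration.integral_add exp_average_integrable)

lemma exp_average_diff:
  fixes h k :: "'a :: real_normed_vector \<Rightarrow> real"
  assumes "\<mu> > 0" "h \<in> bcontfun" "k \<in> bcontfun"
  shows "exp_average \<mu> \<omega> (\<lambda>x. h x - k x) \<psi> = exp_average \<mu> \<omega> h \<psi> - exp_average \<mu> \<omega> k \<psi>"
  unfolding exp_average_def using assms by (intro Bochner_Integration.integral_diff exp_average_integrable)

lemma exp_average_ge:
  fixes h :: "'a :: real_normed_vector \<Rightarrow> real"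
  assumes "\<mu> > 0" "h \<in> bcontfun" "\<And>x. c \<le> h x"
  shows "c \<le> exp_average \<mu> \<omega> h \<psi>"
  using exp_average_mono[OF assms(1) const_bcontfun assms(2), of c] assms by (simp add: exp_average_const)

lemma exp_average_le:
  fixes h :: "'a :: real_normed_vector \<Rightarrow> real"
  assumes "\<mu> > 0" "h \<in> bcontfun" "\<And>x. h x \<le> c"
  shows "exp_average \<mu> \<omega> h \<psi> \<le> c"
  using exp_average_mono[OF assms(1) assms(2) const_bcontfun, of c] assms by (simp add: exp_average_const)

lemma exp_average_abs_le:
  fixes h :: "'a :: real_normed_vector \<Rightarrow> real"
  assumes "\<mu> > 0" "h \<in> bcontfun" "\<And>x. \<bar>h x\<bar> \<le> c"
  shows "\<bar>exp_average \<mu> \<omega> h \<psi>\<bar> \<le> c"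
proof -
  have "h x \<le> c" "- c \<le> h x" for x using assms(3)[of x] by auto
  then show ?thesis using exp_average_le[OF assms(1,2)] exp_average_ge[OF assms(1,2)] 
    by (simp add: abs_le_iff) (metis minus_le_iff)
qed

text \<open>Continuity is dominated convergence: the integrands are bounded by a constant, which is integrable for
a probability measure.\<close>

lemma exp_average_bcontfun:
  fixes h :: "'a :: real_normed_vector \<Rightarrow> real"
  assumes "\<mu> > 0" "h \<in> bcontfun"
  shows "exp_average \<mu> \<omega> h \<in> bcontfun"
proof -
  interpret prob_space "density lborel (exponential_density \<mu>)"
    using assms(1) by (rule prob_space_exponential_density)
  obtain B where B: "\<And>x. \<bar>h x\<bar> \<le> B" and h: "continuous_on UNIV h"
    using assms by (auto simp: real_bcontfun_iff)
  have "isCont (exp_average \<mu> \<omega> h) \<psi>" for \<psi>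
    unfolding continuous_at_sequentially
  proof (intro allI impI)
    fix x :: "nat \<Rightarrow> 'a" assume x: "x \<longlonglongrightarrow> \<psi>"
    show "(exp_average \<mu> \<omega> h \<circ> x) \<longlonglongrightarrow> exp_average \<mu> \<omega> h \<psi>"
      unfolding exp_average_def comp_def
    proof (rule integral_dominated_convergence[where w = "\<lambda>_. B"])
      show "(\<lambda>s. h (\<psi> - s *\<^sub>R \<omega>)) \<in> borel_measurable (density lborel (exponential_density \<mu>))" for \<psi>
        using exp_average_integrable[OF assms] by (rule borel_measurable_integrable)
      then show "(\<lambda>s. h (x i - s *\<^sub>R \<omega>)) \<in> borel_measurable (density lborel (exponential_density \<mu>))" for i .
      have "isCont h y" for y using h by (simp add: continuous_on_eq_continuous_at)
      then have "(\<lambda>i. h (x i - s *\<^sub>R \<omega>)) \<longlonglongrightarrow> h (\<psi> - s *\<^sub>R \<omega>)" for s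
        by (rule isCont_tendsto_compose) (intro tendsto_intros x)
      then show "AE s in density lborel (exponential_density \<mu>).
          (\<lambda>i. h (x i - s *\<^sub>R \<omega>)) \<longlonglongrightarrow> h (\<psi> - s *\<^sub>R \<omega>)" by simp
    qed (use B in auto)
  qed
  then show ?thesis
    using exp_average_abs_le[OF assms B] by (auto simp: real_bcontfun_iff continuous_on_eq_continuous_at)
qed

lemma exp_average_periodic:
  assumes "\<And>x. h (x + v) = h x"
  shows "exp_average \<mu> \<omega> h (\<psi> + v) = exp_average \<mu> \<omega> h \<psi>"
proof -
  have "h (\<psi> + v - s *\<^sub>R \<omega>) = h (\<psi> - s *\<^sub>R \<omega>)" for s
    using assms[of "\<psi> - s *\<^sub>R \<omega>"] by (simp add: algebra_simps)
  then show ?thesis by (simp add: exp_average_def)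
qed

lemma DERIV_integral_atMost:
  fixes q :: "real \<Rightarrow> real"
  assumes q: "continuous_on UNIV q" and int: "\<And>t. set_integrable lborel {..t} q"
  shows "((\<lambda>t. LINT s:{..t}|lborel. q s) has_real_derivative q t) (at t)"
proof -
  have eq: "(LINT s:{..u}|lborel. q s) = (LINT s:{..t-1}|lborel. q s) + integral {t-1..u} q"
    if "u \<in> {t-1<..<t+1}" for u
  proof -
    have i1: "set_integrable lborel {t-1..u} q"
      by (rule borel_integrable_atLeastAtMost') (rule continuous_on_subset[OF q], auto)
    then have i2: "set_integrable lborel {t-1<..u} q"
      by (rule set_integrable_subset) auto
    have "{..u} = {..t-1} \<union> {t-1<..u}" using that by auto
    then have "(LINT s:{..u}|lborel. q s) = (LINT s:{..t-1}|lborel. q s) + (LINT s:{t-1<..u}|lborel. q s)"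
      using int[of "t - 1"] i2 by (simp only:) (rule set_integral_Un, auto)
    also have "(LINT s:{t-1<..u}|lborel. q s) = (LINT s:{t-1..u}|lborel. q s)"
    proof (rule set_integral_cong_set)
      show "AE s in lborel. (s \<in> {t-1..u}) = (s \<in> {t-1<..u})"
        using AE_lborel_singleton[of "t - 1"] by eventually_elim auto
    qed (use i1 i2 in \<open>auto simp: set_integrable_def set_borel_measurable_def\<close>)
    also have "\<dots> = integral {t-1..u} q" by (rule set_borel_integral_eq_integral(2)[OF i1])
    finally show ?thesis .
  qed
  have "((\<lambda>u. integral {t-1..u} q) has_real_derivative q t) (at t within {t-1..t+1})"
    by (rule integral_has_real_derivative) (auto intro: continuous_on_subset[OF q])
  then have "((\<lambda>u. integral {t-1..u} q) has_real_derivative q t) (at t)"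
    by (simp add: at_within_Icc_at)
  then have "((\<lambda>u. (LINT s:{..t-1}|lborel. q s) + integral {t-1..u} q) has_real_derivative q t) (at t)"
    by (auto intro!: derivative_eq_intros)
  then show ?thesis
    by (rule has_field_derivative_transform_within_open[of _ _ _ "{t-1<..<t+1}"]) (use eq in auto)
qed

text \<open>Along the flow the average is \<open>\<mu> e\<^sup>-\<^sup>\<mu>\<^sup>t\<close> times the integral of \<open>e\<^sup>\<mu>\<^sup>r h(\<psi> + r \<omega>)\<close> over \<open>r \<le> t\<close>, so that it
can be differentiated although \<open>h\<close> is merely continuous.\<close>

lemma exp_average_DERIV:
  fixes h :: "'a :: real_normed_vector \<Rightarrow> real"
  assumes \<mu>: "\<mu> > 0" and h: "h \<in> bcontfun"
  shows "((\<lambda>t. exp_average \<mu> \<omega> h (\<psi> + t *\<^sub>R \<omega>)) has_real_derivative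
    \<mu> * (h (\<psi> + t *\<^sub>R \<omega>) - exp_average \<mu> \<omega> h (\<psi> + t *\<^sub>R \<omega>))) (at t)"
proof -
  define q where "q r = \<mu> * exp (\<mu> * r) * h (\<psi> + r *\<^sub>R \<omega>)" for r
  \<comment> \<open>the integrand after the substitution \<open>r = t - s\<close>, which moves \<open>t\<close> out of the argument of \<open>h\<close>\<close>
  define g where "g t = (\<lambda>r. exponential_density \<mu> (t - r) * h (\<psi> + r *\<^sub>R \<omega>))" for t
  have cont: "continuous_on UNIV (\<lambda>s. h (\<psi> + s *\<^sub>R \<omega>))" for \<psi> \<omega>
    using h by (auto simp: real_bcontfun_iff intro!: continuous_on_compose2[of UNIV h] continuous_intros)
  have meas: "(\<lambda>s. h (\<psi> + s *\<^sub>R \<omega>)) \<in> borel_measurable lborel" for \<psi> \<omega>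
    using borel_measurable_continuous_onI[OF cont] by simp
  have meas': "(\<lambda>s. h (\<psi> - s *\<^sub>R \<omega>)) \<in> borel_measurable lborel" for \<psi> \<omega>
    using meas[of \<psi> "- \<omega>"] by simp
  have int: "integrable lborel (\<lambda>s. exponential_density \<mu> s * h (\<psi> + t *\<^sub>R \<omega> - s *\<^sub>R \<omega>))" for t
    using exp_average_integrable[OF \<mu> h, of "\<psi> + t *\<^sub>R \<omega>" \<omega>] meas' \<mu>
    by (subst (asm) integrable_density) auto
  have gint: "integrable lborel (g t)" for t
    using lborel_integrable_real_affine[OF int, of "-1" t t] by (simp add: g_def algebra_simps)
  have avg: "exp_average \<mu> \<omega> h (\<psi> + t *\<^sub>R \<omega>) = (\<integral>r. g t r \<partial>lborel)" for t
  proof -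
    have "exp_average \<mu> \<omega> h (\<psi> + t *\<^sub>R \<omega>)
        = (\<integral>s. exponential_density \<mu> s * h (\<psi> + t *\<^sub>R \<omega> - s *\<^sub>R \<omega>) \<partial>lborel)"
      unfolding exp_average_def using meas' \<mu> by (subst integral_density) auto
    also have "\<dots> = (\<integral>r. g t r \<partial>lborel)"
      by (subst lborel_integral_real_affine[where c = "-1" and t = t]) (auto simp: g_def algebra_simps)
    finally show ?thesis .
  qed
  have gq: "g t r = exp (- \<mu> * t) * (indicator {..t} r *\<^sub>R q r)" for t r
    by (auto simp: g_def q_def exponential_density_def indicator_def algebra_simps exp_diff exp_minus field_simps)
  have qint: "set_integrable lborel {..t} q" for t
  proof -
    have "integrable lborel (\<lambda>r. exp (\<mu> * t) * g t r)" using gint by simp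
    then show ?thesis by (simp add: set_integrable_def gq exp_minus)
  qed
  have avg': "exp_average \<mu> \<omega> h (\<psi> + t *\<^sub>R \<omega>) = exp (- \<mu> * t) * (LINT s:{..t}|lborel. q s)" for t
    unfolding avg set_lebesgue_integral_def gq by simp
  have qcont: "continuous_on UNIV q"
    unfolding q_def by (intro continuous_intros cont)
  show ?thesis
    unfolding avg'
    by (rule derivative_eq_intros DERIV_integral_atMost[OF qcont qint] refl)+
      (simp add: q_def exp_minus field_simps)
qed

text \<open>Integration by parts, in the form of a uniqueness argument: the difference of the two sides along the
flow is bounded and solves \<open>v' = -\<mu> v\<close>.\<close>

lemma exp_average_flow_derivative:
  fixes \<Phi> D :: "'a :: real_normed_vector \<Rightarrow> real"
  assumes \<mu>: "\<mu> > 0" and \<Phi>: "\<Phi> \<in> bcontfun" and D: "D \<in> bcontfun"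
    and der: "\<And>\<psi> t. ((\<lambda>t. \<Phi> (\<psi> + t *\<^sub>R \<omega>)) has_real_derivative D (\<psi> + t *\<^sub>R \<omega>)) (at t)"
  shows "exp_average \<mu> \<omega> D \<psi> = \<mu> * (\<Phi> \<psi> - exp_average \<mu> \<omega> \<Phi> \<psi>)"
proof -
  define v where "v t = exp_average \<mu> \<omega> D (\<psi> + t *\<^sub>R \<omega>)
    - \<mu> * (\<Phi> (\<psi> + t *\<^sub>R \<omega>) - exp_average \<mu> \<omega> \<Phi> (\<psi> + t *\<^sub>R \<omega>))" for t
  obtain A B where A: "\<And>x. \<bar>D x\<bar> \<le> A" and B: "\<And>x. \<bar>\<Phi> x\<bar> \<le> B"
    using \<Phi> D by (auto simp: real_bcontfun_iff)
  have "\<bar>v 0\<bar> \<le> 0 / \<mu>"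
  proof (rule bounded_solution_bound[OF \<mu>, of v "\<lambda>t. - \<mu> * v t"])
    show "(v has_real_derivative - \<mu> * v t) (at t)" for t
      unfolding v_def
      by (rule DERIV_cong[OF DERIV_diff[OF exp_average_DERIV[OF \<mu> D]
          DERIV_cmult[OF DERIV_diff[OF der exp_average_DERIV[OF \<mu> \<Phi>]]]]]) (simp add: algebra_simps)
    show "\<bar>v t\<bar> \<le> A + \<mu> * (B + B)" for t
    proof -
      have "\<bar>\<Phi> (\<psi> + t *\<^sub>R \<omega>) - exp_average \<mu> \<omega> \<Phi> (\<psi> + t *\<^sub>R \<omega>)\<bar> \<le> B + B"
        using B[of "\<psi> + t *\<^sub>R \<omega>"] exp_average_abs_le[OF \<mu> \<Phi> B, of \<omega> "\<psi> + t *\<^sub>R \<omega>"] by linarith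
      then have "\<bar>\<mu> * (\<Phi> (\<psi> + t *\<^sub>R \<omega>) - exp_average \<mu> \<omega> \<Phi> (\<psi> + t *\<^sub>R \<omega>))\<bar> \<le> \<mu> * (B + B)"
        using \<mu> by (simp add: abs_mult)
      then show ?thesis
        using exp_average_abs_le[OF \<mu> D A, of \<omega> "\<psi> + t *\<^sub>R \<omega>"] unfolding v_def by linarith
    qed
  qed simp
  then show ?thesis by (simp add: v_def)
qed

text \<open>The operator \<open>d\<^sup>2/dt\<^sup>2 + (\<mu>\<^sub>1 + \<mu>\<^sub>2) d/dt + \<mu>\<^sub>1 \<mu>\<^sub>2\<close> is the product of \<open>d/dt + \<mu>\<^sub>1\<close> and \<open>d/dt + \<mu>\<^sub>2\<close>, and each
factor is inverted by an exponential average.\<close>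

lemma overdamped_response:
  fixes h :: "'a :: real_normed_vector \<Rightarrow> real" and \<omega> :: 'a
  assumes \<mu>: "\<mu>1 > 0" "\<mu>2 > 0" and h: "h \<in> bcontfun"
  defines "Y \<equiv> exp_average \<mu>1 \<omega> h"
  defines "X \<equiv> \<lambda>\<psi>. exp_average \<mu>2 \<omega> Y \<psi> / (\<mu>1 * \<mu>2)"
  defines "X' \<equiv> \<lambda>\<psi>. (Y \<psi> - exp_average \<mu>2 \<omega> Y \<psi>) / \<mu>1"
  shows "((\<lambda>t. X (t *\<^sub>R \<omega>)) has_real_derivative X' (t *\<^sub>R \<omega>)) (at t)"
    and "((\<lambda>t. X' (t *\<^sub>R \<omega>)) has_real_derivative
      h (t *\<^sub>R \<omega>) - (\<mu>1 + \<mu>2) * X' (t *\<^sub>R \<omega>) - \<mu>1 * \<mu>2 * X (t *\<^sub>R \<omega>)) (at t)"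
proof -
  have Y: "Y \<in> bcontfun" unfolding Y_def by (rule exp_average_bcontfun[OF \<mu>(1) h])
  have dY: "((\<lambda>t. Y (t *\<^sub>R \<omega>)) has_real_derivative \<mu>1 * (h (t *\<^sub>R \<omega>) - Y (t *\<^sub>R \<omega>))) (at t)"
    using exp_average_DERIV[OF \<mu>(1) h, of \<omega> 0 t] by (simp add: Y_def)
  have dZ: "((\<lambda>t. exp_average \<mu>2 \<omega> Y (t *\<^sub>R \<omega>)) has_real_derivative
      \<mu>2 * (Y (t *\<^sub>R \<omega>) - exp_average \<mu>2 \<omega> Y (t *\<^sub>R \<omega>))) (at t)"
    using exp_average_DERIV[OF \<mu>(2) Y, of \<omega> 0 t] by simp
  show "((\<lambda>t. X (t *\<^sub>R \<omega>)) has_real_derivative X' (t *\<^sub>R \<omega>)) (at t)"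
    unfolding X_def X'_def
    by (rule DERIV_cong[OF DERIV_cdivide[OF dZ]]) (use \<mu> in \<open>simp add: field_simps\<close>)
  show "((\<lambda>t. X' (t *\<^sub>R \<omega>)) has_real_derivative
      h (t *\<^sub>R \<omega>) - (\<mu>1 + \<mu>2) * X' (t *\<^sub>R \<omega>) - \<mu>1 * \<mu>2 * X (t *\<^sub>R \<omega>)) (at t)"
    unfolding X_def X'_def
    by (rule DERIV_cong[OF DERIV_cdivide[OF DERIV_diff[OF dY dZ]]])
      (use \<mu> in \<open>simp add: field_simps\<close>)
qed

section \<open>Fourier series and primitives along the flow\<close>

lemma exp_idx_dot_periodic:
  fixes \<nu> :: "int ^ 'd"
  shows "exp (\<i> * complex_of_real (idx_dot (\<psi> + axis i (2 * pi)) \<nu>)) = exp (\<i> * complex_of_real (idx_dot \<psi> \<nu>))"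
proof -
  have "idx_dot (\<psi> + axis i (2 * pi)) \<nu> = idx_dot \<psi> \<nu> + (\<Sum>j\<in>UNIV. if j = i then 2 * pi * real_of_int (\<nu> $ i) else 0)"
    unfolding idx_dot_def sum.distrib[symmetric] by (rule sum.cong) (auto simp: axis_def algebra_simps)
  also have "\<dots> = idx_dot \<psi> \<nu> + 2 * pi * real_of_int (\<nu> $ i)"
    by simp
  finally have "\<i> * complex_of_real (idx_dot (\<psi> + axis i (2 * pi)) \<nu>)
      = \<i> * complex_of_real (idx_dot \<psi> \<nu>) + \<i> * (of_int (\<nu> $ i) * (of_real pi * 2))"
    by (simp add: algebra_simps)
  then show ?thesis by (simp only: exp_plus_2pin)
qed

lemma idx_dot_line: "idx_dot (\<psi> + t *\<^sub>R \<omega>) \<nu> = idx_dot \<psi> \<nu> + t * idx_dot \<omega> \<nu>"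
  by (simp add: idx_dot_def algebra_simps sum.distrib sum_distrib_left)

lemma continuous_on_idx_dot: "continuous_on A (\<lambda>\<psi>. idx_dot \<psi> \<nu>)"
  unfolding idx_dot_def by (intro continuous_intros)

text \<open>A finite Fourier sum without constant term has a primitive along the flow as soon as its divisors
\<open>\<omega> \<cdot> \<nu>\<close> do not vanish.\<close>

lemma diophantine_nonresonant:
  assumes "C0 > 0" "diophantine C0 \<tau> \<omega>" "\<nu> \<noteq> 0"
  shows "idx_dot \<omega> \<nu> \<noteq> 0"
proof -
  have "idx_norm \<nu> > 0"
  proof -
    obtain i where "\<nu> $ i \<noteq> 0" using assms(3) by (metis vec_eq_iff zero_index)
    then have "0 < (\<Sum>i\<in>UNIV. \<bar>\<nu> $ i\<bar>)" by (intro sum_pos2[of _ i]) auto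
    then show ?thesis unfolding idx_norm_def by (simp only: of_int_0_less_iff)
  qed
  then have "0 < C0 * idx_norm \<nu> powr (- \<tau>)" using assms(1) by simp
  also have "\<dots> \<le> \<bar>idx_dot \<omega> \<nu>\<bar>" using assms(2,3) by (simp add: diophantine_def)
  finally show ?thesis by auto
qed

text \<open>A convergent series of complex numbers over a set converges absolutely, so evaluation at \<open>\<psi> = 0\<close> shows
that the coefficients are summable and that finite partial sums approximate \<open>f\<close> uniformly. A single
harmonic with \<open>\<nu> \<noteq> 0\<close> is the derivative along the flow of itself divided by \<open>\<i> \<omega> \<cdot> \<nu>\<close>.\<close>

lemma Fourier_flow_primitive:
  fixes \<omega> :: "real ^ 'd" and c :: "int ^ 'd \<Rightarrow> complex"
  assumes sum: "\<And>\<psi>. ((\<lambda>\<nu>. exp (\<i> * complex_of_real (idx_dot \<psi> \<nu>)) * c \<nu>) has_sum f \<psi>) UNIV"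
    and nonres: "\<forall>\<nu>. \<nu> \<noteq> 0 \<longrightarrow> idx_dot \<omega> \<nu> \<noteq> 0"
    and "e > 0"
  shows "\<exists>\<Phi> D. \<Phi> \<in> bcontfun \<and> D \<in> bcontfun \<and>
    (\<forall>\<psi> t. ((\<lambda>t. \<Phi> (\<psi> + t *\<^sub>R \<omega>)) has_vector_derivative D (\<psi> + t *\<^sub>R \<omega>)) (at t)) \<and>
    (\<forall>\<psi>. norm (f \<psi> - c 0 - D \<psi>) \<le> e)"
proof -
  define E where "E \<psi> \<nu> = exp (\<i> * complex_of_real (idx_dot \<psi> \<nu>))" for \<psi> and \<nu> :: "int ^ 'd"
  have norm_E [simp]: "norm (E \<psi> \<nu>) = 1" for \<psi> \<nu>
    by (simp add: E_def)
  have cont_E: "continuous_on UNIV (\<lambda>\<psi>. E \<psi> \<nu>)" for \<nu>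
    unfolding E_def by (intro continuous_intros continuous_on_idx_dot)
  have E_deriv: "((\<lambda>t. E (\<psi> + t *\<^sub>R \<omega>) \<nu>) has_vector_derivative
      \<i> * complex_of_real (idx_dot \<omega> \<nu>) * E (\<psi> + t *\<^sub>R \<omega>) \<nu>) (at t)" for \<psi> \<nu> t
  proof -
    have "((\<lambda>z. exp (\<i> * (complex_of_real (idx_dot \<psi> \<nu>) + z * complex_of_real (idx_dot \<omega> \<nu>))))
        has_field_derivative
        \<i> * complex_of_real (idx_dot \<omega> \<nu>) * E (\<psi> + t *\<^sub>R \<omega>) \<nu>) (at (complex_of_real t))"
      by (auto intro!: derivative_eq_intros simp: E_def idx_dot_line)
    from has_vector_derivative_real_field[OF this] show ?thesis
      by (simp add: E_def idx_dot_line)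
  qed
  have "(\<lambda>\<nu>. E 0 \<nu> * c \<nu>) summable_on UNIV"
    using sum[of 0] by (auto simp: E_def summable_on_def)
  then have "(\<lambda>\<nu>. norm (E 0 \<nu> * c \<nu>)) summable_on UNIV"
    by (simp only: summable_on_iff_abs_summable_on_complex)
  then have "(\<lambda>\<nu>. norm (c \<nu>)) summable_on UNIV"
    by (simp add: norm_mult)
  then obtain N where N: "((\<lambda>\<nu>. norm (c \<nu>)) has_sum N) UNIV"
    by (auto simp: summable_on_def)
  obtain S0 where S0: "finite S0" "dist (\<Sum>\<nu>\<in>S0. norm (c \<nu>)) N \<le> e"
    using has_sum_finite_approximation[OF N \<open>e > 0\<close>] by auto
  \<comment> \<open>The mean has no primitive along the flow; it is treated separately as \<open>c 0\<close>.\<close>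
  define S where "S = S0 - {0}"
  have fin: "finite S" and 0: "0 \<notin> S" using S0(1) by (auto simp: S_def)
  define D where "D \<psi> = (\<Sum>\<nu>\<in>S. c \<nu> * E \<psi> \<nu>)" for \<psi>
  define \<Phi> where "\<Phi> \<psi> = (\<Sum>\<nu>\<in>S. c \<nu> / (\<i> * complex_of_real (idx_dot \<omega> \<nu>)) * E \<psi> \<nu>)" for \<psi>
  have bcont: "(\<lambda>\<psi>. \<Sum>\<nu>\<in>S. a \<nu> * E \<psi> \<nu>) \<in> bcontfun" for a :: "int ^ 'd \<Rightarrow> complex"
    by (rule bcontfun_normI[where b = "\<Sum>\<nu>\<in>S. norm (a \<nu>)"])
      (auto intro!: continuous_intros cont_E sum_norm_le simp: norm_mult)
  have "((\<lambda>t. \<Phi> (\<psi> + t *\<^sub>R \<omega>)) has_vector_derivative D (\<psi> + t *\<^sub>R \<omega>)) (at t)" for \<psi> t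
  proof -
    have "((\<lambda>t. \<Phi> (\<psi> + t *\<^sub>R \<omega>)) has_vector_derivative
       (\<Sum>\<nu>\<in>S. c \<nu> / (\<i> * complex_of_real (idx_dot \<omega> \<nu>)) *
          (\<i> * complex_of_real (idx_dot \<omega> \<nu>) * E (\<psi> + t *\<^sub>R \<omega>) \<nu>))) (at t)"
      unfolding \<Phi>_def
      by (intro has_vector_derivative_sum has_vector_derivative_mult_right E_deriv)
    also have "(\<Sum>\<nu>\<in>S. c \<nu> / (\<i> * complex_of_real (idx_dot \<omega> \<nu>)) *
          (\<i> * complex_of_real (idx_dot \<omega> \<nu>) * E (\<psi> + t *\<^sub>R \<omega>) \<nu>)) = D (\<psi> + t *\<^sub>R \<omega>)"
      unfolding D_def
    proof (rule sum.cong)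
      fix \<nu> assume "\<nu> \<in> S"
      then have "idx_dot \<omega> \<nu> \<noteq> 0" using 0 nonres by metis
      then show "c \<nu> / (\<i> * complex_of_real (idx_dot \<omega> \<nu>)) *
          (\<i> * complex_of_real (idx_dot \<omega> \<nu>) * E (\<psi> + t *\<^sub>R \<omega>) \<nu>) = c \<nu> * E (\<psi> + t *\<^sub>R \<omega>) \<nu>"
        by simp
    qed simp
    finally show ?thesis .
  qed
  moreover have "norm (f \<psi> - c 0 - D \<psi>) \<le> e" for \<psi>
  proof -
    have fin': "finite (insert 0 S)" using fin by simp
    have "((\<lambda>\<nu>. E \<psi> \<nu> * c \<nu>) has_sum (f \<psi> - (\<Sum>\<nu>\<in>insert 0 S. E \<psi> \<nu> * c \<nu>))) (UNIV - insert 0 S)"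
      using sum[of \<psi>] fin' by (intro has_sum_Diff has_sum_finite) (auto simp: E_def)
    moreover have "((\<lambda>\<nu>. norm (c \<nu>)) has_sum (N - (\<Sum>\<nu>\<in>insert 0 S. norm (c \<nu>)))) (UNIV - insert 0 S)"
      using N fin' by (intro has_sum_Diff has_sum_finite) auto
    ultimately have "norm (f \<psi> - (\<Sum>\<nu>\<in>insert 0 S. E \<psi> \<nu> * c \<nu>)) \<le> N - (\<Sum>\<nu>\<in>insert 0 S. norm (c \<nu>))"
      by (rule norm_infsum_le) (simp add: norm_mult)
    also have "\<dots> \<le> N - (\<Sum>\<nu>\<in>S0. norm (c \<nu>))"
      using fin' by (intro diff_left_mono sum_mono2) (auto simp: S_def)
    also have "\<dots> \<le> e" using S0(2) by (simp add: dist_real_def)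
    also have "f \<psi> - (\<Sum>\<nu>\<in>insert 0 S. E \<psi> \<nu> * c \<nu>) = f \<psi> - c 0 - D \<psi>"
      using fin 0 by (simp add: D_def E_def idx_dot_def mult.commute)
    finally show ?thesis .
  qed
  moreover have "\<Phi> \<in> bcontfun" "D \<in> bcontfun"
    unfolding \<Phi>_def D_def by (rule bcont)+
  ultimately show ?thesis by blast
qed

text \<open>The average of a real function is real. If \<open>c 0\<close> had an imaginary part, the imaginary part of \<open>D\<close> would
have to cancel most of it at every point of an orbit, and the bounded primitive \<open>Im \<Phi>\<close> would drift
without bound.\<close>

lemma Fourier_mean_real:
  fixes \<omega> :: "real ^ 'd" and c :: "int ^ 'd \<Rightarrow> complex"
  assumes sum: "\<And>\<psi>. ((\<lambda>\<nu>. exp (\<i> * complex_of_real (idx_dot \<psi> \<nu>)) * c \<nu>) has_sum complex_of_real (f \<psi>)) UNIV"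
    and nonres: "\<forall>\<nu>. \<nu> \<noteq> 0 \<longrightarrow> idx_dot \<omega> \<nu> \<noteq> 0"
  shows "Im (c 0) = 0"
proof (rule ccontr)
  assume "Im (c 0) \<noteq> 0"
  define e where "e = \<bar>Im (c 0)\<bar> / 4"
  have e: "e > 0" using \<open>Im (c 0) \<noteq> 0\<close> by (simp add: e_def)
  obtain \<Phi> D where \<Phi>: "\<Phi> \<in> bcontfun" "D \<in> bcontfun"
    and der: "\<And>\<psi> t. ((\<lambda>t. \<Phi> (\<psi> + t *\<^sub>R \<omega>)) has_vector_derivative D (\<psi> + t *\<^sub>R \<omega>)) (at t)"
    and app: "\<And>\<psi>. norm (complex_of_real (f \<psi>) - c 0 - D \<psi>) \<le> e"
    using Fourier_flow_primitive[OF sum nonres e] by blast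
  obtain B where B: "\<And>\<psi>. norm (\<Phi> \<psi>) \<le> B" "B \<ge> 0"
    using \<Phi>(1) norm_ge_zero order_trans unfolding bcontfun_def bounded_iff by blast
  \<comment> \<open>long enough for a drift of speed \<open>e\<close> to exceed the diameter of the range of \<open>\<Phi>\<close>\<close>
  define T where "T = 2 * B / e + 1"
  have T: "T > 0" using B(2) e by (simp add: T_def add_nonneg_pos)
  have "((\<lambda>t. Im (\<Phi> (0 + t *\<^sub>R \<omega>))) has_real_derivative Im (D (0 + t *\<^sub>R \<omega>))) (at t)" for t
    unfolding has_real_derivative_iff_has_vector_derivative
    by (rule bounded_linear.has_vector_derivative[OF bounded_linear_Im der])
  then have "\<exists>z. 0 < z \<and> z < T \<and> Im (\<Phi> (0 + T *\<^sub>R \<omega>)) - Im (\<Phi> (0 + 0 *\<^sub>R \<omega>)) = (T - 0) * Im (D (0 + z *\<^sub>R \<omega>))"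
    using T by (intro MVT2) auto
  then obtain z where z: "Im (\<Phi> (0 + T *\<^sub>R \<omega>)) - Im (\<Phi> (0 + 0 *\<^sub>R \<omega>)) = T * Im (D (0 + z *\<^sub>R \<omega>))"
    by auto
  have "\<bar>Im (c 0) + Im (D (0 + z *\<^sub>R \<omega>))\<bar> \<le> e"
    using abs_Im_le_cmod[of "complex_of_real (f (0 + z *\<^sub>R \<omega>)) - c 0 - D (0 + z *\<^sub>R \<omega>)"]
      app[of "0 + z *\<^sub>R \<omega>"] by simp
  then have "3 * e \<le> \<bar>Im (D (0 + z *\<^sub>R \<omega>))\<bar>" unfolding e_def by linarith
  then have "T * (3 * e) \<le> \<bar>T * Im (D (0 + z *\<^sub>R \<omega>))\<bar>"
    using T by (simp add: abs_mult)
  also have "\<dots> \<le> 2 * B"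
    using abs_Im_le_cmod[of "\<Phi> (0 + T *\<^sub>R \<omega>)"] abs_Im_le_cmod[of "\<Phi> (0 + 0 *\<^sub>R \<omega>)"]
      B(1)[of "0 + T *\<^sub>R \<omega>"] B(1)[of "0 + 0 *\<^sub>R \<omega>"] unfolding z[symmetric] by linarith
  finally have "T * (3 * e) \<le> 2 * B" .
  moreover have "T * (3 * e) = 6 * B + 3 * e" using e by (simp add: T_def field_simps)
  ultimately show False using e B(2) by linarith
qed

lemma real_flow_primitive:
  fixes \<omega> :: "real ^ 'd" and c :: "int ^ 'd \<Rightarrow> complex"
  assumes sum: "\<And>\<psi>. ((\<lambda>\<nu>. exp (\<i> * complex_of_real (idx_dot \<psi> \<nu>)) * c \<nu>) has_sum complex_of_real (f \<psi>)) UNIV"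
    and nonres: "\<forall>\<nu>. \<nu> \<noteq> 0 \<longrightarrow> idx_dot \<omega> \<nu> \<noteq> 0"
    and "e > 0"
  shows "\<exists>\<Phi> D. \<Phi> \<in> bcontfun \<and> D \<in> bcontfun \<and>
    (\<forall>\<psi> t. ((\<lambda>t. \<Phi> (\<psi> + t *\<^sub>R \<omega>)) has_real_derivative D (\<psi> + t *\<^sub>R \<omega>)) (at t)) \<and>
    (\<forall>\<psi>. \<bar>f \<psi> - Re (c 0) - D \<psi>\<bar> \<le> e)"
proof -
  obtain \<Phi> D where \<Phi>: "\<Phi> \<in> bcontfun" "D \<in> bcontfun"
    and der: "\<And>\<psi> t. ((\<lambda>t. \<Phi> (\<psi> + t *\<^sub>R \<omega>)) has_vector_derivative D (\<psi> + t *\<^sub>R \<omega>)) (at t)"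
    and app: "\<And>\<psi>. norm (complex_of_real (f \<psi>) - c 0 - D \<psi>) \<le> e"
    using Fourier_flow_primitive[OF sum nonres \<open>e > 0\<close>] by blast
  have bc: "(\<lambda>\<psi>. Re (h \<psi>)) \<in> bcontfun" if "h \<in> bcontfun" for h :: "real ^ 'd \<Rightarrow> complex"
  proof -
    from that obtain B where B: "\<And>\<psi>. norm (h \<psi>) \<le> B" and h: "continuous_on UNIV h"
      unfolding bcontfun_def bounded_iff by auto
    then show ?thesis
      using order_trans[OF abs_Re_le_cmod B] by (intro bcontfun_normI[where b = B] continuous_intros) auto
  qed
  show ?thesis
  proof (intro exI conjI allI)
    show "((\<lambda>t. Re (\<Phi> (\<psi> + t *\<^sub>R \<omega>))) has_real_derivative Re (D (\<psi> + t *\<^sub>R \<omega>))) (at t)" for \<psi> t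
      unfolding has_real_derivative_iff_has_vector_derivative
      by (rule bounded_linear.has_vector_derivative[OF bounded_linear_Re]) (use der in blast)
    show "\<bar>f \<psi> - Re (c 0) - Re (D \<psi>)\<bar> \<le> e" for \<psi>
      using abs_Re_le_cmod[of "complex_of_real (f \<psi>) - c 0 - D \<psi>"] app[of \<psi>] by simp
  qed (use bc \<Phi> in auto)
qed

text \<open>Uniform limits of the trigonometric polynomials from \<open>real_flow_primitive\<close> are continuous and bounded.\<close>

lemma Fourier_sum_bcontfun:
  fixes \<omega> :: "real ^ 'd" and c :: "int ^ 'd \<Rightarrow> complex"
  assumes sum: "\<And>\<psi>. ((\<lambda>\<nu>. exp (\<i> * complex_of_real (idx_dot \<psi> \<nu>)) * c \<nu>) has_sum complex_of_real (f \<psi>)) UNIV"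
    and nonres: "\<forall>\<nu>. \<nu> \<noteq> 0 \<longrightarrow> idx_dot \<omega> \<nu> \<noteq> 0"
  shows "f \<in> bcontfun"
proof -
  have "\<exists>D. D \<in> bcontfun \<and> (\<forall>\<psi>. \<bar>f \<psi> - Re (c 0) - D \<psi>\<bar> \<le> e)" if "e > 0" for e
    using real_flow_primitive[OF sum nonres that] by blast
  then have "\<forall>n. \<exists>D. D \<in> bcontfun \<and> (\<forall>\<psi>. \<bar>f \<psi> - Re (c 0) - D \<psi>\<bar> \<le> inverse (real (Suc n)))"
    by simp
  then obtain D where D: "\<And>n. D n \<in> bcontfun"
    and app: "\<And>n \<psi>. \<bar>f \<psi> - Re (c 0) - D n \<psi>\<bar> \<le> inverse (real (Suc n))"
    by metis
  have "uniform_limit UNIV (\<lambda>n \<psi>. D n \<psi> + Re (c 0)) f sequentially"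
  proof (rule uniform_limitI)
    fix e :: real assume "e > 0"
    then have "eventually (\<lambda>n. inverse (real (Suc n)) < e) sequentially"
      by (rule order_tendstoD(2)[OF LIMSEQ_inverse_real_of_nat])
    then show "eventually (\<lambda>n. \<forall>\<psi>\<in>UNIV. dist (D n \<psi> + Re (c 0)) (f \<psi>) < e) sequentially"
    proof eventually_elim
      case (elim n)
      show ?case
      proof
        fix \<psi>
        show "dist (D n \<psi> + Re (c 0)) (f \<psi>) < e"
          using app[of \<psi> n] elim by (auto simp: dist_real_def abs_le_iff)
      qed
    qed
  qed
  moreover have "continuous_on UNIV (\<lambda>\<psi>. D n \<psi> + Re (c 0))" for n
    using D[of n] by (auto simp: real_bcontfun_iff intro!: continuous_intros)
  ultimately have "continuous_on UNIV f"
    by (intro uniform_limit_theorem[of _ "\<lambda>n \<psi>. D n \<psi> + Re (c 0)" sequentially]) auto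
  moreover obtain B where B: "\<And>\<psi>. \<bar>D 0 \<psi>\<bar> \<le> B"
    using D[of 0] by (auto simp: real_bcontfun_iff)
  have "\<bar>f \<psi>\<bar> \<le> B + \<bar>Re (c 0)\<bar> + 1" for \<psi>
    using app[of \<psi> 0] B[of \<psi>] by simp
  ultimately show ?thesis by (auto simp: real_bcontfun_iff)
qed

lemma Fourier_sum_periodic:
  fixes c :: "int ^ 'd \<Rightarrow> complex"
  assumes sum: "\<And>\<psi>. ((\<lambda>\<nu>. exp (\<i> * complex_of_real (idx_dot \<psi> \<nu>)) * c \<nu>) has_sum complex_of_real (f \<psi>)) UNIV"
  shows "f (\<psi> + axis i (2 * pi)) = f \<psi>"
  using sum[of "\<psi> + axis i (2 * pi)"] sum[of \<psi>] has_sum_unique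
  unfolding exp_idx_dot_periodic by (metis of_real_eq_iff)

section \<open>The response to strong damping\<close>

lemma damping_roots:
  fixes \<gamma> \<kappa> :: real
  assumes "0 < \<kappa>" "0 < \<gamma>" "4 * \<kappa> < \<gamma>\<^sup>2"
  obtains \<mu>1 \<mu>2 where "0 < \<mu>1" "\<gamma> / 2 \<le> \<mu>2" "\<mu>1 + \<mu>2 = \<gamma>" "\<mu>1 * \<mu>2 = \<kappa>"
proof
  define s where "s = sqrt (\<gamma>\<^sup>2 - 4 * \<kappa>)"
  have s2: "s * s = \<gamma>\<^sup>2 - 4 * \<kappa>" using assms by (simp add: s_def)
  have "s < sqrt (\<gamma>\<^sup>2)" unfolding s_def using assms by (intro real_sqrt_less_mono) simp
  then have s: "0 \<le> s" "s < \<gamma>" using assms by (auto simp: s_def)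
  show "0 < (\<gamma> - s) / 2" "\<gamma> / 2 \<le> (\<gamma> + s) / 2" "(\<gamma> - s) / 2 + (\<gamma> + s) / 2 = \<gamma>"
    using s by (auto simp: field_simps)
  have "(\<gamma> - s) / 2 * ((\<gamma> + s) / 2) = (\<gamma>\<^sup>2 - s * s) / 4" by (simp add: power2_eq_square algebra_simps)
  then show "(\<gamma> - s) / 2 * ((\<gamma> + s) / 2) = \<kappa>" by (simp add: s2)
qed

text \<open>The bound is relevant for \<open>\<mu>1\<close> small and \<open>\<mu>2\<close> large with \<open>\<mu>1 * \<mu>2\<close> fixed: averaging over the long time
\<open>1/\<mu>1\<close> suppresses derivatives along the flow.\<close>

lemma double_average_small:
  fixes h :: "'a :: real_normed_vector \<Rightarrow> real"
  assumes \<mu>: "\<mu>1 > 0" "\<mu>2 > 0" and bc: "h \<in> bcontfun" "\<Phi> \<in> bcontfun" "D \<in> bcontfun"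
    and der: "\<And>\<psi> t. ((\<lambda>t. \<Phi> (\<psi> + t *\<^sub>R \<omega>)) has_real_derivative D (\<psi> + t *\<^sub>R \<omega>)) (at t)"
    and app: "\<And>\<psi>. \<bar>h \<psi> - D \<psi>\<bar> \<le> e" and B: "\<And>\<psi>. \<bar>\<Phi> \<psi>\<bar> \<le> B"
  shows "\<bar>exp_average \<mu>2 \<omega> (exp_average \<mu>1 \<omega> h) \<psi>\<bar> \<le> e + 2 * B * \<mu>1"
proof (rule exp_average_abs_le[OF \<mu>(2) exp_average_bcontfun[OF \<mu>(1) bc(1)]])
  fix \<psi>
  have "\<bar>\<Phi> \<psi> - exp_average \<mu>1 \<omega> \<Phi> \<psi>\<bar> \<le> 2 * B"
    using B[of \<psi>] exp_average_abs_le[OF \<mu>(1) bc(2) B, of \<omega> \<psi>] by linarith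
  then have D: "\<bar>exp_average \<mu>1 \<omega> D \<psi>\<bar> \<le> 2 * B * \<mu>1"
    using \<mu>(1) by (simp add: exp_average_flow_derivative[OF \<mu>(1) bc(2,3) der] abs_mult mult.commute)
  have "\<bar>exp_average \<mu>1 \<omega> h \<psi> - exp_average \<mu>1 \<omega> D \<psi>\<bar> \<le> e"
    unfolding exp_average_diff[OF \<mu>(1) bc(1,3), symmetric]
    by (intro exp_average_abs_le[OF \<mu>(1)] minus_cont bc app)
  then show "\<bar>exp_average \<mu>1 \<omega> h \<psi>\<bar> \<le> e + 2 * B * \<mu>1" using D by linarith
qed

text \<open>Banach's fixed point theorem for \<open>X \<mapsto> \<kappa>\<^sup>-\<^sup>1 J (f + \<kappa> X - X\<^sup>n)\<close>, with \<open>J\<close> the double average, on the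
functions with values within \<open>\<bar>a\<bar>/2\<close> of \<open>a\<close> and with all elements of \<open>P\<close> as periods. Let \<open>\<beta>\<close> be the
smallest slope of \<open>x\<^sup>n\<close> on this range. Two functions are contracted by the factor \<open>1 - \<beta>/\<kappa>\<close>, and the
smallness hypothesis says that the constant function \<open>a\<close> moves by at most \<open>\<beta>/\<kappa>\<close> times \<open>\<bar>a\<bar>/2\<close>; the two
together keep the ball of radius \<open>\<bar>a\<bar>/2\<close> invariant.\<close>

lemma averaged_fixed_point:
  fixes f :: "'a :: real_normed_vector \<Rightarrow> real" and a :: real and p :: nat and P :: "'a set"
  defines "\<kappa> \<equiv> real (2 * p + 1) * (3 * \<bar>a\<bar> / 2) ^ (2 * p)"
  assumes a: "a \<noteq> 0" and f: "f \<in> bcontfun" and per: "\<forall>\<psi>. \<forall>v\<in>P. f (\<psi> + v) = f \<psi>"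
    and \<mu>: "\<mu>1 > 0" "\<mu>2 > 0" "\<mu>1 * \<mu>2 = \<kappa>"
    and small: "\<And>\<psi>. \<bar>exp_average \<mu>2 \<omega> (exp_average \<mu>1 \<omega> (\<lambda>\<psi>. f \<psi> - a ^ (2 * p + 1))) \<psi>\<bar> \<le> e"
    and e: "e \<le> real (2 * p + 1) * (\<bar>a\<bar> / 2) ^ (2 * p) * (\<bar>a\<bar> / 2)"
  shows "\<exists>X. X \<in> bcontfun \<and> (\<forall>\<psi>. \<forall>v\<in>P. X (\<psi> + v) = X \<psi>) \<and> (\<forall>\<psi>. \<bar>X \<psi> - a\<bar> \<le> \<bar>a\<bar> / 2) \<and>
    (\<forall>\<psi>. X \<psi> = exp_average \<mu>2 \<omega> (exp_average \<mu>1 \<omega> (\<lambda>\<psi>. f \<psi> + \<kappa> * X \<psi> - X \<psi> ^ (2 * p + 1))) \<psi> / (\<mu>1 * \<mu>2))"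
proof -
  define J where "J h = exp_average \<mu>2 \<omega> (exp_average \<mu>1 \<omega> h)" for h
  define N where "N x = \<kappa> * x - x ^ (2 * p + 1)" for x
  define \<beta> where "\<beta> = real (2 * p + 1) * (\<bar>a\<bar> / 2) ^ (2 * p)"
  have \<kappa>: "\<kappa> > 0" using a by (simp add: \<kappa>_def)
  have \<beta>: "0 < \<beta>" "\<beta> \<le> \<kappa>"
    using a unfolding \<beta>_def \<kappa>_def by (auto intro!: mult_left_mono power_mono)
  have div: "\<bar>x / \<kappa>\<bar> \<le> c / \<kappa>" if "\<bar>x\<bar> \<le> c" for x c
    using divide_right_mono[OF that, of \<kappa>] \<kappa> by simp
  have J_bc: "J h \<in> bcontfun" if "h \<in> bcontfun" for h
    unfolding J_def by (intro exp_average_bcontfun \<mu>(1,2) that)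
  have J_add: "J (\<lambda>\<psi>. h \<psi> + k \<psi>) \<psi> = J h \<psi> + J k \<psi>" if "h \<in> bcontfun" "k \<in> bcontfun" for h k \<psi>
  proof -
    have "exp_average \<mu>1 \<omega> (\<lambda>\<psi>. h \<psi> + k \<psi>) = (\<lambda>\<psi>. exp_average \<mu>1 \<omega> h \<psi> + exp_average \<mu>1 \<omega> k \<psi>)"
      by (rule ext) (rule exp_average_add[OF \<mu>(1) that])
    then show ?thesis unfolding J_def
      by (simp add: exp_average_add[OF \<mu>(2) exp_average_bcontfun exp_average_bcontfun] \<mu>(1) that)
  qed
  have J_abs: "\<bar>J h \<psi>\<bar> \<le> c" if "h \<in> bcontfun" "\<And>\<psi>. \<bar>h \<psi>\<bar> \<le> c" for h c \<psi>
    unfolding J_def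
    by (intro exp_average_abs_le exp_average_bcontfun \<mu>(1,2) that)
  have J_const: "J (\<lambda>_. c) \<psi> = c" for c \<psi>
  proof -
    have "exp_average \<mu>1 \<omega> (\<lambda>_. c) = (\<lambda>_. c)" by (rule ext) (rule exp_average_const[OF \<mu>(1)])
    then show ?thesis by (simp add: J_def exp_average_const \<mu>(2))
  qed
  have J_per: "J h (\<psi> + v) = J h \<psi>" if "\<And>\<psi>. h (\<psi> + v) = h \<psi>" for h v \<psi>
    unfolding J_def by (intro exp_average_periodic that)
  have N_bc: "(\<lambda>\<psi>. N (X \<psi>)) \<in> bcontfun" if "X \<in> bcontfun" for X :: "'a \<Rightarrow> real"
    using that unfolding N_def by (rule bcontfun_compose) (intro continuous_intros)
  have rhs_bc: "(\<lambda>\<psi>. f \<psi> + N (X \<psi>)) \<in> bcontfun" if "X \<in> bcontfun" for X :: "'a \<Rightarrow> real"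
    by (intro plus_cont f N_bc that)
  have N_lip: "\<bar>N x - N y\<bar> \<le> (\<kappa> - \<beta>) * \<bar>x - y\<bar>" if "\<bar>x - a\<bar> \<le> \<bar>a\<bar> / 2" "\<bar>y - a\<bar> \<le> \<bar>a\<bar> / 2" for x y
    using odd_power_contraction[OF that, of p] by (simp add: N_def \<kappa>_def \<beta>_def)
  define T where "T X = Bcontfun (\<lambda>\<psi>. J (\<lambda>\<psi>. f \<psi> + N (apply_bcontfun X \<psi>)) \<psi> / \<kappa>)" for X
  have T: "apply_bcontfun (T X) \<psi> = J (\<lambda>\<psi>. f \<psi> + N (apply_bcontfun X \<psi>)) \<psi> / \<kappa>" for X \<psi>
  proof -
    have "(\<lambda>\<psi>. J (\<lambda>\<psi>. f \<psi> + N (apply_bcontfun X \<psi>)) \<psi> / \<kappa>) \<in> bcontfun"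
      using scaleR_cont[OF J_bc[OF rhs_bc[OF apply_bcontfun[of X]]], of "1 / \<kappa>"] by simp
    then show ?thesis unfolding T_def by (simp add: Bcontfun_inverse)
  qed
  define S where "S = {X :: 'a \<Rightarrow>\<^sub>C real. \<forall>\<psi>. \<bar>X \<psi> - a\<bar> \<le> \<bar>a\<bar> / 2 \<and> (\<forall>v\<in>P. X (\<psi> + v) = X \<psi>)}"
  \<comment> \<open>All conditions defining \<open>S\<close> are closed because evaluation at a point is continuous.\<close>
  have ev: "continuous_on UNIV (\<lambda>X :: 'a \<Rightarrow>\<^sub>C real. X \<psi>)" for \<psi>
    unfolding continuous_on_iff using dist_fun_lt_imp_dist_val_lt by blast
  have "closed S"
    unfolding S_def Ball_def
    by (intro closed_Collect_all closed_Collect_conj closed_Collect_imp closed_Collect_le closed_Collect_eq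
        continuous_intros ev open_Collect_const)
  then have compl: "complete S" by (simp add: complete_eq_closed)
  have "const_bcontfun a \<in> S" by (simp add: S_def const_bcontfun.rep_eq)
  then have ne: "S \<noteq> {}" by blast
  have diff: "apply_bcontfun (T X) \<psi> - apply_bcontfun (T Y) \<psi>
      = J (\<lambda>\<psi>. N (apply_bcontfun X \<psi>) - N (apply_bcontfun Y \<psi>)) \<psi> / \<kappa>" for X Y \<psi>
  proof -
    have "J (\<lambda>\<psi>. f \<psi> + N (apply_bcontfun X \<psi>)) \<psi>
        = J (\<lambda>\<psi>. (f \<psi> + N (apply_bcontfun Y \<psi>)) + (N (apply_bcontfun X \<psi>) - N (apply_bcontfun Y \<psi>))) \<psi>"
      by simp
    also have "\<dots> = J (\<lambda>\<psi>. f \<psi> + N (apply_bcontfun Y \<psi>)) \<psi>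
        + J (\<lambda>\<psi>. N (apply_bcontfun X \<psi>) - N (apply_bcontfun Y \<psi>)) \<psi>"
      by (intro J_add rhs_bc minus_cont N_bc apply_bcontfun)
    finally show ?thesis by (simp add: T diff_divide_distrib[symmetric])
  qed
  have fix_a: "\<bar>T (const_bcontfun a) \<psi> - a\<bar> \<le> e / \<kappa>" for \<psi>
  proof -
    have "J (\<lambda>\<psi>. f \<psi> + N a) \<psi> = J (\<lambda>\<psi>. (f \<psi> - a ^ (2 * p + 1)) + \<kappa> * a) \<psi>"
      by (simp add: N_def algebra_simps)
    also have "\<dots> = J (\<lambda>\<psi>. f \<psi> - a ^ (2 * p + 1)) \<psi> + \<kappa> * a"
      using J_add[of "\<lambda>\<psi>. f \<psi> - a ^ (2 * p + 1)" "\<lambda>_. \<kappa> * a" \<psi>] f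
      by (simp add: J_const minus_cont const_bcontfun)
    finally have "T (const_bcontfun a) \<psi> - a = J (\<lambda>\<psi>. f \<psi> - a ^ (2 * p + 1)) \<psi> / \<kappa>"
      using \<kappa> by (simp add: T const_bcontfun.rep_eq add_divide_distrib)
    then show ?thesis
      using div[OF small[of \<psi>]] by (simp only: J_def)
  qed
  have into: "T X \<in> S" if X: "X \<in> S" for X
  proof -
    have XS: "\<bar>X \<psi> - a\<bar> \<le> \<bar>a\<bar> / 2" for \<psi> using X by (simp add: S_def)
    have "\<bar>T X \<psi> - a\<bar> \<le> \<bar>a\<bar> / 2" for \<psi>
    proof -
      have "\<bar>N (X \<psi>) - N a\<bar> \<le> (\<kappa> - \<beta>) * (\<bar>a\<bar> / 2)" for \<psi>
        by (rule order_trans[OF N_lip[OF XS] mult_left_mono[OF XS]]) (use \<beta> in auto)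
      then have "\<bar>J (\<lambda>\<psi>. N (X \<psi>) - N a) \<psi>\<bar> \<le> (\<kappa> - \<beta>) * (\<bar>a\<bar> / 2)"
        by (intro J_abs minus_cont N_bc apply_bcontfun const_bcontfun)
      then have "\<bar>T X \<psi> - T (const_bcontfun a) \<psi>\<bar> \<le> (\<kappa> - \<beta>) * (\<bar>a\<bar> / 2) / \<kappa>"
        unfolding diff const_bcontfun.rep_eq by (rule div)
      then have "\<bar>T X \<psi> - a\<bar> \<le> (\<kappa> - \<beta>) * (\<bar>a\<bar> / 2) / \<kappa> + e / \<kappa>"
        using fix_a[of \<psi>] by linarith
      also have "\<dots> \<le> (\<kappa> - \<beta>) * (\<bar>a\<bar> / 2) / \<kappa> + \<beta> * (\<bar>a\<bar> / 2) / \<kappa>"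
        using e \<kappa> by (intro add_left_mono divide_right_mono) (auto simp: \<beta>_def)
      also have "\<dots> = \<bar>a\<bar> / 2"
        using \<kappa> by (simp add: field_simps)
      finally show ?thesis .
    qed
    moreover have "T X (\<psi> + v) = T X \<psi>" if "v \<in> P" for \<psi> v
    proof -
      have "J (\<lambda>\<psi>. f \<psi> + N (X \<psi>)) (\<psi> + v) = J (\<lambda>\<psi>. f \<psi> + N (X \<psi>)) \<psi>"
        using X that per by (intro J_per) (auto simp: S_def)
      then show ?thesis by (simp add: T)
    qed
    ultimately show ?thesis by (simp add: S_def)
  qed
  have lip: "dist (T X) (T Y) \<le> (1 - \<beta> / \<kappa>) * dist X Y" if "X \<in> S" "Y \<in> S" for X Y
  proof (rule dist_bound)
    fix \<psi>
    have "\<bar>N (X \<psi>) - N (Y \<psi>)\<bar> \<le> (\<kappa> - \<beta>) * dist X Y" for \<psi>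
    proof -
      have "\<bar>N (X \<psi>) - N (Y \<psi>)\<bar> \<le> (\<kappa> - \<beta>) * \<bar>X \<psi> - Y \<psi>\<bar>"
        using that by (intro N_lip) (auto simp: S_def)
      also have "\<dots> \<le> (\<kappa> - \<beta>) * dist X Y"
        using \<beta> dist_bounded[of X \<psi> Y] by (intro mult_left_mono) (auto simp: dist_real_def)
      finally show ?thesis .
    qed
    then have "\<bar>J (\<lambda>\<psi>. N (X \<psi>) - N (Y \<psi>)) \<psi>\<bar> \<le> (\<kappa> - \<beta>) * dist X Y"
      by (intro J_abs minus_cont N_bc apply_bcontfun)
    then have "\<bar>T X \<psi> - T Y \<psi>\<bar> \<le> (\<kappa> - \<beta>) * dist X Y / \<kappa>"
      unfolding diff by (rule div)
    also have "\<dots> = (1 - \<beta> / \<kappa>) * dist X Y" using \<kappa> by (simp add: field_simps)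
    finally show "dist (T X \<psi>) (T Y \<psi>) \<le> (1 - \<beta> / \<kappa>) * dist X Y" by (simp add: dist_real_def)
  qed
  have "\<exists>!X\<in>S. T X = X"
  proof (rule Banach_fix[OF compl ne])
    show "0 \<le> 1 - \<beta> / \<kappa>" "1 - \<beta> / \<kappa> < 1" using \<beta> \<kappa> by auto
  qed (use into lip in auto)
  then obtain X where X: "X \<in> S" "T X = X" by blast
  have "X \<psi> = J (\<lambda>\<psi>. f \<psi> + \<kappa> * X \<psi> - X \<psi> ^ (2 * p + 1)) \<psi> / (\<mu>1 * \<mu>2)" for \<psi>
    using T[of X \<psi>] unfolding X(2) by (simp add: \<mu>(3) N_def add_diff_eq)
  then show ?thesis
    using X(1) apply_bcontfun[of X] unfolding S_def J_def
    by (intro exI[of _ "apply_bcontfun X"]) blast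
qed

text \<open>The constant \<open>\<kappa>\<close> and the size required of the double average depend on \<open>a\<close> and \<open>p\<close> alone, so one
approximate primitive \<open>\<Phi>\<close> of \<open>f - a\<^sup>n\<close> serves all large \<open>\<gamma>\<close>. The smallness of \<open>x'\<close> follows from
\<open>bounded_solution_bound\<close>, because \<open>x'' + \<gamma> x' = f - x\<^sup>n\<close> has a right side bounded independently of \<open>\<gamma>\<close>.\<close>

lemma eventually_bounded_response:
  fixes f :: "'a :: real_normed_vector \<Rightarrow> real" and a :: real and p :: nat and P :: "'a set"
  assumes a: "a \<noteq> 0" and f: "f \<in> bcontfun" and per: "\<forall>\<psi>. \<forall>v\<in>P. f (\<psi> + v) = f \<psi>"
    and prim: "\<forall>e>0. \<exists>\<Phi> D. \<Phi> \<in> bcontfun \<and> D \<in> bcontfun \<and>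
      (\<forall>\<psi> t. ((\<lambda>t. \<Phi> (\<psi> + t *\<^sub>R \<omega>)) has_real_derivative D (\<psi> + t *\<^sub>R \<omega>)) (at t)) \<and>
      (\<forall>\<psi>. \<bar>f \<psi> - a ^ (2 * p + 1) - D \<psi>\<bar> \<le> e)"
  shows "\<forall>\<^sub>F \<gamma> in at_top. \<exists>X x'. X \<in> bcontfun \<and> (\<forall>\<psi>. \<forall>v\<in>P. X (\<psi> + v) = X \<psi>) \<and>
    (\<forall>\<psi>. \<bar>a\<bar> / 2 \<le> \<bar>X \<psi>\<bar>) \<and>
    (\<forall>t. ((\<lambda>t. X (t *\<^sub>R \<omega>)) has_real_derivative x' t) (at t)) \<and>
    (\<forall>t. (x' has_real_derivative f (t *\<^sub>R \<omega>) - \<gamma> * x' t - X (t *\<^sub>R \<omega>) ^ (2 * p + 1)) (at t)) \<and>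
    (\<forall>t. 8 * real (2 * p + 1) ^ 2 * \<bar>x' t\<bar> \<le> \<gamma> * (\<bar>a\<bar> / 2))"
proof -
  define \<kappa> where "\<kappa> = real (2 * p + 1) * (3 * \<bar>a\<bar> / 2) ^ (2 * p)"
  define e where "e = real (2 * p + 1) * (\<bar>a\<bar> / 2) ^ (2 * p) * (\<bar>a\<bar> / 2)"
  have \<kappa>: "\<kappa> > 0" and e: "e > 0" using a by (auto simp: \<kappa>_def e_def)
  have f_mean: "(\<lambda>\<psi>. f \<psi> - a ^ (2 * p + 1)) \<in> bcontfun"
    by (intro minus_cont f const_bcontfun)
  obtain \<Phi> D where \<Phi>: "\<Phi> \<in> bcontfun" and D: "D \<in> bcontfun"
    and der: "\<And>\<psi> t. ((\<lambda>t. \<Phi> (\<psi> + t *\<^sub>R \<omega>)) has_real_derivative D (\<psi> + t *\<^sub>R \<omega>)) (at t)"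
    and app: "\<And>\<psi>. \<bar>f \<psi> - a ^ (2 * p + 1) - D \<psi>\<bar> \<le> e / 2"
    using prim[rule_format, of "e / 2"] e by auto
  obtain B where B: "\<And>\<psi>. \<bar>\<Phi> \<psi>\<bar> \<le> B" using \<Phi> by (auto simp: real_bcontfun_iff)
  obtain A where A: "\<And>\<psi>. \<bar>f \<psi>\<bar> \<le> A" using f by (auto simp: real_bcontfun_iff)
  have B0: "0 \<le> B" using B[of 0] by linarith
  define G where "G = A + (3 * \<bar>a\<bar> / 2) ^ (2 * p + 1)"
  let ?P = "\<lambda>\<gamma>. \<exists>X x'. X \<in> bcontfun \<and> (\<forall>\<psi>. \<forall>v\<in>P. X (\<psi> + v) = X \<psi>) \<and>
    (\<forall>\<psi>. \<bar>a\<bar> / 2 \<le> \<bar>X \<psi>\<bar>) \<and>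
    (\<forall>t. ((\<lambda>t. X (t *\<^sub>R \<omega>)) has_real_derivative x' t) (at t)) \<and>
    (\<forall>t. (x' has_real_derivative f (t *\<^sub>R \<omega>) - \<gamma> * x' t - X (t *\<^sub>R \<omega>) ^ (2 * p + 1)) (at t)) \<and>
    (\<forall>t. 8 * real (2 * p + 1) ^ 2 * \<bar>x' t\<bar> \<le> \<gamma> * (\<bar>a\<bar> / 2))"
  have "?P \<gamma>"
    if \<gamma>: "1 \<le> \<gamma>" "4 * \<kappa> < \<gamma>" "8 * B * \<kappa> / e \<le> \<gamma>" "16 * real (2 * p + 1) ^ 2 * G / \<bar>a\<bar> \<le> \<gamma>" for \<gamma>
  proof -
    \<comment> \<open>The four conditions serve, in this order, to replace \<open>\<gamma>\<^sup>2\<close> by \<open>\<gamma>\<close>, to make the roots of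
      \<open>\<mu>\<^sup>2 - \<gamma> \<mu> + \<kappa>\<close> real, to make the forcing average out, and to make the solution slow.\<close>
    have sq: "\<gamma> \<le> \<gamma>\<^sup>2" using \<gamma>(1) by (simp add: power2_eq_square)
    then obtain \<mu>1 \<mu>2 where \<mu>: "0 < \<mu>1" "\<gamma> / 2 \<le> \<mu>2" "\<mu>1 + \<mu>2 = \<gamma>" "\<mu>1 * \<mu>2 = \<kappa>"
      using damping_roots[of \<kappa> \<gamma>] \<kappa> \<gamma> by auto
    have \<mu>2: "0 < \<mu>2" using \<mu>(2) \<gamma>(1) by linarith
    have "2 * B * \<mu>1 \<le> e / 2"
    proof -
      have "\<mu>1 * (\<gamma> / 2) \<le> \<kappa>" using \<mu> by (metis less_imp_le mult_left_mono)
      then have "4 * B * (\<mu>1 * \<gamma>) \<le> 4 * B * (2 * \<kappa>)" using B0 by (intro mult_left_mono) auto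
      also have "\<dots> \<le> \<gamma> * e" using \<gamma>(3) e by (simp add: field_simps)
      finally have "\<gamma> * (4 * B * \<mu>1) \<le> \<gamma> * e" by (simp add: mult_ac)
      then show ?thesis using \<gamma>(1) by simp
    qed
    then have small: "\<bar>exp_average \<mu>2 \<omega> (exp_average \<mu>1 \<omega> (\<lambda>\<psi>. f \<psi> - a ^ (2 * p + 1))) \<psi>\<bar> \<le> e" for \<psi>
      using double_average_small[OF \<mu>(1) \<mu>2 f_mean \<Phi> D der app B, of \<psi>] by linarith
    have "\<exists>X. X \<in> bcontfun \<and> (\<forall>\<psi>. \<forall>v\<in>P. X (\<psi> + v) = X \<psi>) \<and> (\<forall>\<psi>. \<bar>X \<psi> - a\<bar> \<le> \<bar>a\<bar> / 2) \<and>
        (\<forall>\<psi>. X \<psi> = exp_average \<mu>2 \<omega> (exp_average \<mu>1 \<omega>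
          (\<lambda>\<psi>. f \<psi> + \<kappa> * X \<psi> - X \<psi> ^ (2 * p + 1))) \<psi> / (\<mu>1 * \<mu>2))"
      unfolding \<kappa>_def
      by (rule averaged_fixed_point[OF a f per \<mu>(1) \<mu>2 \<mu>(4)[unfolded \<kappa>_def] small]) (simp add: e_def)
    then obtain X where X: "X \<in> bcontfun" "\<forall>\<psi>. \<forall>v\<in>P. X (\<psi> + v) = X \<psi>" "\<And>\<psi>. \<bar>X \<psi> - a\<bar> \<le> \<bar>a\<bar> / 2"
      and fixp: "\<And>\<psi>. X \<psi> = exp_average \<mu>2 \<omega> (exp_average \<mu>1 \<omega>
        (\<lambda>\<psi>. f \<psi> + \<kappa> * X \<psi> - X \<psi> ^ (2 * p + 1))) \<psi> / (\<mu>1 * \<mu>2)"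
      by blast
    define h where "h \<psi> = f \<psi> + \<kappa> * X \<psi> - X \<psi> ^ (2 * p + 1)" for \<psi>
    define Y where "Y = exp_average \<mu>1 \<omega> h"
    define X' where "X' \<psi> = (Y \<psi> - exp_average \<mu>2 \<omega> Y \<psi>) / \<mu>1" for \<psi>
    have h: "h \<in> bcontfun"
    proof -
      have "(\<lambda>\<psi>. \<kappa> * X \<psi> - X \<psi> ^ (2 * p + 1)) \<in> bcontfun"
        by (rule bcontfun_compose[OF X(1)]) (intro continuous_intros)
      from plus_cont[OF f this] show ?thesis by (simp add: h_def[abs_def] add_diff_eq)
    qed
    have Y: "Y \<in> bcontfun" unfolding Y_def by (rule exp_average_bcontfun[OF \<mu>(1) h])
    have X_eq: "X = (\<lambda>\<psi>. exp_average \<mu>2 \<omega> Y \<psi> / (\<mu>1 * \<mu>2))"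
      unfolding Y_def h_def[abs_def] by (rule ext) (rule fixp)
    have dX: "((\<lambda>t. X (t *\<^sub>R \<omega>)) has_real_derivative X' (t *\<^sub>R \<omega>)) (at t)" for t
      unfolding X_eq X'_def Y_def by (rule overdamped_response(1)[OF \<mu>(1) \<mu>2 h])
    have "((\<lambda>t. X' (t *\<^sub>R \<omega>)) has_real_derivative
        h (t *\<^sub>R \<omega>) - (\<mu>1 + \<mu>2) * X' (t *\<^sub>R \<omega>) - \<mu>1 * \<mu>2 * X (t *\<^sub>R \<omega>)) (at t)" for t
      using overdamped_response(2)[OF \<mu>(1) \<mu>2 h, of \<omega> t]
      unfolding Y_def[symmetric] X'_def[symmetric] fun_cong[OF X_eq, symmetric] .
    then have dX': "((\<lambda>t. X' (t *\<^sub>R \<omega>)) has_real_derivative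
        f (t *\<^sub>R \<omega>) - \<gamma> * X' (t *\<^sub>R \<omega>) - X (t *\<^sub>R \<omega>) ^ (2 * p + 1)) (at t)" for t
      by (rule DERIV_cong) (simp add: \<mu>(3,4) h_def)
    obtain C where C: "\<And>\<psi>. \<bar>Y \<psi>\<bar> \<le> C" using Y by (auto simp: real_bcontfun_iff)
    have slow: "\<bar>X' (t *\<^sub>R \<omega>)\<bar> \<le> G / \<gamma>" for t
    proof (rule bounded_solution_bound[where v = "\<lambda>t. X' (t *\<^sub>R \<omega>)", OF _ dX'])
      show "0 < \<gamma>" using \<gamma>(1) by simp
      show "\<bar>f (t *\<^sub>R \<omega>) - \<gamma> * X' (t *\<^sub>R \<omega>) - X (t *\<^sub>R \<omega>) ^ (2 * p + 1) + \<gamma> * X' (t *\<^sub>R \<omega>)\<bar> \<le> G" for t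
      proof -
        have "\<bar>X (t *\<^sub>R \<omega>)\<bar> \<le> 3 * \<bar>a\<bar> / 2" using X(3)[of "t *\<^sub>R \<omega>"] by linarith
        then have "\<bar>X (t *\<^sub>R \<omega>) ^ (2 * p + 1)\<bar> \<le> (3 * \<bar>a\<bar> / 2) ^ (2 * p + 1)"
          unfolding power_abs by (intro power_mono) auto
        then show ?thesis using A[of "t *\<^sub>R \<omega>"] unfolding G_def by linarith
      qed
      show "\<bar>X' (t *\<^sub>R \<omega>)\<bar> \<le> (C + C) / \<mu>1" for t
      proof -
        have "\<bar>Y (t *\<^sub>R \<omega>) - exp_average \<mu>2 \<omega> Y (t *\<^sub>R \<omega>)\<bar> \<le> C + C"
          using C[of "t *\<^sub>R \<omega>"] exp_average_abs_le[OF \<mu>2 Y C, of \<omega> "t *\<^sub>R \<omega>"] by linarith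
        then show ?thesis using \<mu>(1) by (simp add: X'_def abs_divide divide_right_mono)
      qed
    qed
    have "8 * real (2 * p + 1) ^ 2 * \<bar>X' (t *\<^sub>R \<omega>)\<bar> \<le> \<gamma> * (\<bar>a\<bar> / 2)" for t
    proof -
      define N where "N = real (2 * p + 1) ^ 2"
      have "16 * N * G \<le> \<gamma> * \<bar>a\<bar>" using \<gamma>(4) a by (simp add: N_def field_simps)
      also have "\<dots> \<le> \<gamma>\<^sup>2 * \<bar>a\<bar>" using sq by (intro mult_right_mono) auto
      finally have "8 * N * (G / \<gamma>) \<le> \<gamma> * (\<bar>a\<bar> / 2)"
        using \<gamma>(1) by (simp add: field_simps power2_eq_square)
      moreover have "8 * N * \<bar>X' (t *\<^sub>R \<omega>)\<bar> \<le> 8 * N * (G / \<gamma>)"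
        using slow by (intro mult_left_mono) (auto simp: N_def)
      ultimately show ?thesis unfolding N_def by linarith
    qed
    moreover have "\<bar>a\<bar> / 2 \<le> \<bar>X \<psi>\<bar>" for \<psi> using X(3)[of \<psi>] by linarith
    ultimately show ?thesis
      using X(1,2) dX dX' by (intro exI[of _ X] exI[of _ "\<lambda>t. X' (t *\<^sub>R \<omega>)"]) blast
  qed
  moreover have "\<forall>\<^sub>F \<gamma> in at_top. 1 \<le> \<gamma> \<and> 4 * \<kappa> < \<gamma> \<and> 8 * B * \<kappa> / e \<le> \<gamma> \<and>
      16 * real (2 * p + 1) ^ 2 * G / \<bar>a\<bar> \<le> \<gamma>"
    by (intro eventually_conj eventually_ge_at_top eventually_gt_at_top)
  ultimately show ?thesis by (auto elim: eventually_mono)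
qed

section \<open>Attraction to a slow solution away from zero\<close>

lemma solution_on_DERIV:
  assumes "solution_on I p \<gamma> f \<omega> x" "t \<in> I"
  shows "(x has_real_derivative deriv x t) (at t)"
    and "(deriv x has_real_derivative f (t *\<^sub>R \<omega>) - \<gamma> * deriv x t - x t ^ (2 * p + 1)) (at t)"
proof -
  have x: "x differentiable (at t)" "deriv x differentiable (at t)"
    and ode: "deriv (deriv x) t + \<gamma> * deriv x t + x t ^ (2 * p + 1) = f (t *\<^sub>R \<omega>)"
    using assms by (auto simp: solution_on_def)
  show "(x has_real_derivative deriv x t) (at t)"
    using x(1) by (simp add: DERIV_deriv_iff_real_differentiable)
  have "(deriv x has_real_derivative deriv (deriv x) t) (at t)"
    using x(2) by (simp add: DERIV_deriv_iff_real_differentiable)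
  then show "(deriv x has_real_derivative f (t *\<^sub>R \<omega>) - \<gamma> * deriv x t - x t ^ (2 * p + 1)) (at t)"
    by (rule DERIV_cong) (use ode in linarith)
qed

lemma solution_onI:
  assumes "\<And>t. (x has_real_derivative x' t) (at t)"
    and "\<And>t. (x' has_real_derivative f (t *\<^sub>R \<omega>) - \<gamma> * x' t - x t ^ (2 * p + 1)) (at t)"
  shows "solution_on UNIV p \<gamma> f \<omega> x" and "deriv x = x'"
proof -
  show "deriv x = x'" by (rule ext) (rule DERIV_imp_deriv[OF assms(1)])
  then show "solution_on UNIV p \<gamma> f \<omega> x"
    using assms DERIV_imp_deriv[OF assms(2)] real_differentiable_def
    by (auto simp: solution_on_def)
qed

text \<open>A Lyapunov function for the difference of two solutions. The potential part \<open>V\<close> is measured from its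
tangent at the moving point \<open>x0\<close>; its explicit dependence on time is the only term in \<open>L'\<close> without a good
sign, and it is the linearization error multiplied by \<open>x0'\<close>. Since \<open>odd_power_linearization_error\<close> has no
restriction on \<open>x\<close>, the slowness of \<open>x0\<close> controls this term everywhere.\<close>

lemma slow_solution_attracts:
  fixes x x' x0 x0' F :: "real \<Rightarrow> real"
  assumes \<gamma>: "\<gamma> > 0" and m: "m > 0"
    and x0: "\<And>t. t > t0 \<Longrightarrow> (x0 has_real_derivative x0' t) (at t)"
    and x0': "\<And>t. t > t0 \<Longrightarrow> (x0' has_real_derivative F t - \<gamma> * x0' t - x0 t ^ (2 * p + 1)) (at t)"
    and x: "\<And>t. t > t0 \<Longrightarrow> (x has_real_derivative x' t) (at t)"
    and x': "\<And>t. t > t0 \<Longrightarrow> (x' has_real_derivative F t - \<gamma> * x' t - x t ^ (2 * p + 1)) (at t)"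
    and lower: "\<And>t. t > t0 \<Longrightarrow> m \<le> \<bar>x0 t\<bar>"
    and slow: "\<And>t. t > t0 \<Longrightarrow> 8 * real (2 * p + 1) ^ 2 * \<bar>x0' t\<bar> \<le> \<gamma> * m"
  shows "((\<lambda>t. (x t - x0 t, x' t - x0' t)) \<longlongrightarrow> (0, 0)) at_top"
proof -
  define u u' h V where "u t = x t - x0 t" and "u' t = x' t - x0' t"
    and "h t = x t ^ (2 * p + 1) - x0 t ^ (2 * p + 1)"
    and "V t = (x t ^ (2 * p + 2) - x0 t ^ (2 * p + 2)) / real (2 * p + 2) - x0 t ^ (2 * p + 1) * u t" for t
  \<comment> \<open>the error of linearizing the restoring force at \<open>x0 t\<close>\<close>
  define r where "r t = h t - real (2 * p + 1) * x0 t ^ (2 * p) * u t" for t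
  define L where "L t = (u' t)\<^sup>2 / 4 + (u' t + \<gamma> * u t)\<^sup>2 / 4 + V t" for t
  define C where "C = 2 / m ^ (2 * p)"
  \<comment> \<open>\<open>C\<close> bounds \<open>u\<^sup>2\<close> in terms of \<open>h u\<close>, hence \<open>L\<close> in terms of \<open>u'\<^sup>2\<close> and \<open>h u\<close>; \<open>k\<close> is the resulting rate of decay.\<close>
  define k where "k = \<gamma> / 4 / (1 + \<gamma>\<^sup>2 * C / 2)"
  have C: "C > 0" using m by (simp add: C_def)
  have k: "k > 0" "k \<le> \<gamma> / 4" "k * (1 + \<gamma>\<^sup>2 * C / 2) = \<gamma> / 4"
  proof -
    have pos: "1 + \<gamma>\<^sup>2 * C / 2 > 0" using C by (simp add: add_pos_nonneg)
    show "k > 0" unfolding k_def using pos \<gamma> by (intro divide_pos_pos) auto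
    show "k * (1 + \<gamma>\<^sup>2 * C / 2) = \<gamma> / 4"
      unfolding k_def times_divide_eq_left[of "\<gamma> / 4"]
      by (rule nonzero_mult_div_cancel_right) (use pos in linarith)
    have "\<gamma> / 4 * 1 \<le> \<gamma> / 4 * (1 + \<gamma>\<^sup>2 * C / 2)" using C \<gamma> by (intro mult_left_mono) auto
    then show "k \<le> \<gamma> / 4" by (simp only: k_def pos_divide_le_eq[OF pos] mult_1_right)
  qed
  have du: "(u has_real_derivative u' t) (at t)" if "t > t0" for t
    unfolding u_def u'_def using that by (auto intro!: derivative_eq_intros x x0)
  have du': "(u' has_real_derivative - \<gamma> * u' t - h t) (at t)" if "t > t0" for t
    unfolding u'_def h_def using that by (auto intro!: derivative_eq_intros x' x0' simp: algebra_simps)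
  have dV: "(V has_real_derivative h t * u' t + x0' t * r t) (at t)" if "t > t0" for t
  proof -
    have pow: "((\<lambda>t. g t ^ Suc k) has_real_derivative real (Suc k) * g t ^ k * d) (at t)"
      if "(g has_real_derivative d) (at t)" for g d k
      by (rule DERIV_cong[OF DERIV_power_Suc[OF that]]) (simp add: mult_ac)
    have "(V has_real_derivative
        (real (Suc (2 * p + 1)) * x t ^ (2 * p + 1) * x' t - real (Suc (2 * p + 1)) * x0 t ^ (2 * p + 1) * x0' t)
          / real (2 * p + 2)
        - ((real (Suc (2 * p)) * x0 t ^ (2 * p) * x0' t) * u t + u' t * x0 t ^ Suc (2 * p))) (at t)"
      unfolding V_def
      using DERIV_diff[OF DERIV_cdivide[OF DERIV_diff[OF pow[OF x[OF that]] pow[OF x0[OF that]]]]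
          DERIV_mult[OF pow[OF x0[OF that]] du[OF that]], of "2 * p + 1" "2 * p + 1" "real (2 * p + 2)" "2 * p"]
      by simp
    moreover have "(real (Suc (2 * p + 1)) * x t ^ (2 * p + 1) * x' t - real (Suc (2 * p + 1)) * x0 t ^ (2 * p + 1) * x0' t)
          / real (2 * p + 2) = x t ^ (2 * p + 1) * x' t - x0 t ^ (2 * p + 1) * x0' t"
      by (simp add: field_simps)
    ultimately show ?thesis
      by (simp add: h_def r_def u'_def algebra_simps)
  qed
  have u2: "(u t)\<^sup>2 \<le> C * (h t * u t)" if "t > t0" for t
  proof -
    have "m ^ (2 * p) \<le> \<bar>x0 t\<bar> ^ (2 * p)" using lower[OF that] m by (intro power_mono) auto
    then have "m ^ (2 * p) * (u t)\<^sup>2 \<le> (x t ^ (2 * p) + x0 t ^ (2 * p)) * (u t)\<^sup>2"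
      by (intro mult_right_mono) (auto simp: power_even_abs add_increasing)
    also have "\<dots> \<le> 2 * (h t * u t)"
      unfolding u_def h_def by (rule odd_power_gap)
    finally show ?thesis using m by (simp add: C_def field_simps)
  qed
  have hu: "0 \<le> h t * u t" if "t > t0" for t
  proof -
    have "0 \<le> C * (h t * u t)" using u2[OF that] by (rule order_trans[rotated]) simp
    then show ?thesis using C by (simp only: zero_le_mult_iff) auto
  qed
  have r_le: "\<bar>x0' t * r t\<bar> \<le> \<gamma> / 4 * (h t * u t)" if "t > t0" for t
  proof -
    have b: "\<bar>x0 t\<bar> > 0" using lower[OF that] m by linarith
    define N where "N = real (2 * p + 1) ^ 2"
    have "\<bar>x0 t\<bar> * \<bar>r t\<bar> \<le> 2 * N * (h t * u t)"
      using odd_power_linearization_error[of "x0 t" "x t" p] by (simp add: r_def h_def u_def N_def)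
    then have "\<bar>x0' t\<bar> * (\<bar>x0 t\<bar> * \<bar>r t\<bar>) \<le> \<bar>x0' t\<bar> * (2 * N * (h t * u t))"
      by (intro mult_left_mono) auto
    also have "\<dots> = (8 * N * \<bar>x0' t\<bar>) * (h t * u t) / 4" by simp
    also have "\<dots> \<le> (\<gamma> * m) * (h t * u t) / 4"
      using slow[OF that] hu[OF that] by (intro divide_right_mono mult_right_mono) (auto simp: N_def)
    also have "\<dots> \<le> (\<gamma> * \<bar>x0 t\<bar>) * (h t * u t) / 4"
      using lower[OF that] hu[OF that] \<gamma> by (intro divide_right_mono mult_right_mono mult_left_mono) auto
    finally have "\<bar>x0 t\<bar> * \<bar>x0' t * r t\<bar> \<le> \<bar>x0 t\<bar> * (\<gamma> / 4 * (h t * u t))"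
      by (simp add: abs_mult algebra_simps)
    then show ?thesis using b by (simp only: mult_le_cancel_left_pos)
  qed
  have V: "0 \<le> V t" "V t \<le> h t * u t" for t
  proof -
    have "real (2 * p + 2) * x0 t ^ (2 * p + 1) * u t \<le> x t ^ (2 * p + 2) - x0 t ^ (2 * p + 2)"
      unfolding u_def by (rule even_power_above_tangent)
    then show "0 \<le> V t" by (simp add: V_def field_simps)
    have "real (2 * p + 2) * x t ^ (2 * p + 1) * (- u t) \<le> x0 t ^ (2 * p + 2) - x t ^ (2 * p + 2)"
      using even_power_above_tangent[of p "x t" "x0 t"] by (simp add: u_def)
    then show "V t \<le> h t * u t" by (simp add: V_def h_def field_simps)
  qed
  have dL: "(L has_real_derivative - \<gamma> / 2 * (u' t)\<^sup>2 - \<gamma> / 2 * (h t * u t) + x0' t * r t) (at t)"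
    if "t > t0" for t
  proof -
    have "(L has_real_derivative
        (2 * u' t * (- \<gamma> * u' t - h t)) / 4
        + (2 * (u' t + \<gamma> * u t) * ((- \<gamma> * u' t - h t) + \<gamma> * u' t)) / 4
        + (h t * u' t + x0' t * r t)) (at t)"
      unfolding L_def
      by (intro DERIV_add DERIV_cdivide dV that)
        (auto intro!: derivative_eq_intros du[OF that] du'[OF that])
    then show ?thesis by (rule DERIV_cong) (simp add: field_simps power2_eq_square)
  qed
  have decay: "- \<gamma> / 2 * (u' t)\<^sup>2 - \<gamma> / 2 * (h t * u t) + x0' t * r t \<le> - k * L t" if "t > t0" for t
  proof -
    have "(u' t + \<gamma> * u t)\<^sup>2 \<le> 2 * (u' t)\<^sup>2 + 2 * \<gamma>\<^sup>2 * (u t)\<^sup>2"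
      using zero_le_power2[of "u' t - \<gamma> * u t"] by (simp add: power2_eq_square algebra_simps)
    also have "\<dots> \<le> 2 * (u' t)\<^sup>2 + 2 * \<gamma>\<^sup>2 * (C * (h t * u t))"
      using u2[OF that] by (intro add_left_mono mult_left_mono) auto
    finally have "L t \<le> 3 / 4 * (u' t)\<^sup>2 + (1 + \<gamma>\<^sup>2 * C / 2) * (h t * u t)"
      using V(2)[of t] by (simp add: L_def algebra_simps)
    then have "k * L t \<le> k * (3 / 4 * (u' t)\<^sup>2 + (1 + \<gamma>\<^sup>2 * C / 2) * (h t * u t))"
      using k by (intro mult_left_mono) auto
    also have "\<dots> = k * (3 / 4 * (u' t)\<^sup>2) + (k * (1 + \<gamma>\<^sup>2 * C / 2)) * (h t * u t)"
      by (simp add: algebra_simps)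
    also have "\<dots> \<le> \<gamma> / 2 * (u' t)\<^sup>2 + \<gamma> / 4 * (h t * u t)"
      unfolding k(3) using k(2) mult_right_mono[of "k * (3 / 4)" "\<gamma> / 2" "(u' t)\<^sup>2"] \<gamma>
      by (simp add: mult.assoc)
    finally have 1: "k * L t \<le> \<gamma> / 2 * (u' t)\<^sup>2 + \<gamma> / 4 * (h t * u t)" .
    show ?thesis using 1 abs_le_D1[OF r_le[OF that]] by simp
  qed
  define t1 where "t1 = t0 + 1"
  have mono: "L t * exp (k * t) \<le> L t1 * exp (k * t1)" if "t1 \<le> t" for t
  proof (rule DERIV_nonpos_imp_nonincreasing[OF that])
    fix s assume "t1 \<le> s" "s \<le> t"
    then have s: "s > t0" by (simp add: t1_def)
    let ?d = "- \<gamma> / 2 * (u' s)\<^sup>2 - \<gamma> / 2 * (h s * u s) + x0' s * r s"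
    have "((\<lambda>t. L t * exp (k * t)) has_real_derivative (?d + k * L s) * exp (k * s)) (at s)"
      by (auto intro!: derivative_eq_intros dL[OF s] simp: algebra_simps)
    moreover have "(?d + k * L s) * exp (k * s) \<le> 0"
      using decay[OF s] by (intro mult_nonpos_nonneg) auto
    ultimately show "\<exists>y. ((\<lambda>t. L t * exp (k * t)) has_real_derivative y) (at s) \<and> y \<le> 0" by blast
  qed
  have L_le: "L t \<le> L t1 * exp (k * t1) * exp (- (k * t))" if "t1 \<le> t" for t
    using mono[OF that] by (simp add: exp_minus field_simps)
  have ev: "eventually (\<lambda>t. t1 \<le> t) at_top" by (rule eventually_ge_at_top)
  have L0: "((\<lambda>t. 4 * L t) \<longlongrightarrow> 0) at_top"
  proof -
    have "((\<lambda>t. L t1 * exp (k * t1) * exp (- (k * t))) \<longlongrightarrow> L t1 * exp (k * t1) * 0) at_top"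
      using k(1) by (intro tendsto_intros filterlim_compose[OF exp_at_bot]
          filterlim_compose[OF filterlim_uminus_at_bot_at_top]
          filterlim_tendsto_pos_mult_at_top[OF tendsto_const] filterlim_ident) auto
    then have "((\<lambda>t. L t1 * exp (k * t1) * exp (- (k * t))) \<longlongrightarrow> 0) at_top" by simp
    moreover have "0 \<le> L t" for t using V(1)[of t] by (simp add: L_def)
    ultimately have "(L \<longlongrightarrow> 0) at_top"
      using eventually_mono[OF ev L_le]
      by (intro tendsto_sandwich[OF _ _ tendsto_const, of 0 L]) auto
    then show ?thesis by (rule tendsto_mult_right_zero)
  qed
  \<comment> \<open>\<open>L\<close> dominates the squares of \<open>u'\<close> and \<open>u' + \<gamma> u\<close>, and these two determine \<open>u\<close>.\<close>
  have sq: "(g \<longlongrightarrow> 0) at_top" if "\<And>t. (g t)\<^sup>2 \<le> 4 * L t" for g :: "real \<Rightarrow> real"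
  proof -
    have "((\<lambda>t. (g t)\<^sup>2) \<longlongrightarrow> 0) at_top"
      using that by (intro tendsto_sandwich[OF _ _ tendsto_const L0]) auto
    then have "((\<lambda>t. sqrt ((g t)\<^sup>2)) \<longlongrightarrow> sqrt 0) at_top" by (rule tendsto_real_sqrt)
    then show ?thesis by (simp add: tendsto_rabs_zero_iff)
  qed
  have u'0: "(u' \<longlongrightarrow> 0) at_top"
    by (rule sq) (use V(1) in \<open>auto simp: L_def\<close>)
  have "((\<lambda>t. u' t + \<gamma> * u t) \<longlongrightarrow> 0) at_top"
    by (rule sq) (use V(1) in \<open>auto simp: L_def\<close>)
  from tendsto_mult[OF tendsto_const tendsto_diff[OF this u'0], of "1 / \<gamma>"]
  have "(u \<longlongrightarrow> 0) at_top" using \<gamma> by simp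
  from tendsto_Pair[OF this u'0] show ?thesis by (simp add: u_def u'_def)
qed

lemma slow_solution_global_attractor:
  assumes "\<gamma> > 0" "m > 0"
    and sol: "solution_on UNIV p \<gamma> f \<omega> x0"
    and lower: "\<And>t. m \<le> \<bar>x0 t\<bar>"
    and slow: "\<And>t. 8 * real (2 * p + 1) ^ 2 * \<bar>deriv x0 t\<bar> \<le> \<gamma> * m"
  shows "global_attractor p \<gamma> f \<omega> x0"
  unfolding global_attractor_def
proof (intro allI impI)
  fix t0 x assume x: "solution_on {t0<..} p \<gamma> f \<omega> x"
  show "((\<lambda>t. (x t - x0 t, deriv x t - deriv x0 t)) \<longlongrightarrow> (0, 0)) at_top"
  proof (rule slow_solution_attracts[OF assms(1,2), of t0 x0 "deriv x0" "\<lambda>t. f (t *\<^sub>R \<omega>)" p x "deriv x"])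
    fix t assume "t0 < t"
    then show "(x has_real_derivative deriv x t) (at t)"
      "(deriv x has_real_derivative f (t *\<^sub>R \<omega>) - \<gamma> * deriv x t - x t ^ (2 * p + 1)) (at t)"
      using solution_on_DERIV[OF x] by auto
  qed (use solution_on_DERIV[OF sol UNIV_I] lower slow in auto)
qed

section \<open>Recurrence and uniqueness\<close>

lemma lattice_periodic:
  fixes X :: "real ^ 'd \<Rightarrow> 'b"
  assumes per: "\<And>\<psi> i. X (\<psi> + axis i a) = X \<psi>"
  shows "X (\<psi> + (\<chi> i. a * of_int (z i))) = X \<psi>"
proof -
  have nat: "X (\<psi> + axis i (a * real n)) = X \<psi>" for \<psi> i n
  proof (induction n arbitrary: \<psi>)
    case (Suc n)
    have "\<psi> + axis i (a * real (Suc n)) = (\<psi> + axis i a) + axis i (a * real n)"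
      by (simp add: vec_eq_iff axis_def algebra_simps)
    then show ?case using Suc per by metis
  next
    case 0
    have "axis i 0 = (0 :: real ^ 'd)" by (simp add: vec_eq_iff axis_def)
    then show ?case by (simp only: of_nat_0 mult_zero_right add_0_right)
  qed
  have int: "X (\<psi> + axis i (a * of_int k)) = X \<psi>" for \<psi> i k
  proof (cases k rule: int_cases2)
    case (nonneg n)
    then show ?thesis using nat by simp
  next
    case (nonpos n)
    have "\<psi> + axis i (a * of_int k) + axis i (a * real n) = \<psi>"
      by (simp add: vec_eq_iff axis_def nonpos)
    then show ?thesis using nat by metis
  qed
  have "X (\<psi> + (\<Sum>i\<in>A. axis i (a * of_int (z i)))) = X \<psi>" if "finite A" for A
    using that
  proof (induction A arbitrary: \<psi>)
    case (insert j A)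
    then show ?case using int by (simp add: add.assoc[symmetric])
  qed simp
  from this[of UNIV] have "X (\<psi> + (\<Sum>i\<in>UNIV. axis i (a * of_int (z i)))) = X \<psi>" by simp
  also have "(\<Sum>i\<in>UNIV. axis i (a * of_int (z i))) = (\<chi> i. a * of_int (z i))"
    by (simp add: vec_eq_iff axis_def)
  finally show ?thesis .
qed

text \<open>Dirichlet's theorem on simultaneous approximation, applied to \<open>\<omega>/a\<close> scaled by a large factor so that
every positive integer multiple is already a late time.\<close>

lemma linear_flow_recurrent:
  fixes \<omega> :: "real ^ 'd"
  assumes "\<delta> > 0" and "a > 0"
  obtains T and z :: "'d \<Rightarrow> int" where "T \<ge> K" "norm (T *\<^sub>R \<omega> - (\<chi> i. a * of_int (z i))) < \<delta>"
proof -
  define n where "n = CARD('d)"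
  obtain e where e: "bij_betw e {0..<n} (UNIV :: 'd set)"
    using ex_bij_betw_nat_finite[of "UNIV :: 'd set"] by (auto simp: n_def)
  define \<kappa> where "\<kappa> = max K 1"
  obtain N :: nat where "max 1 (real n * a / \<delta>) < real N"
    using reals_Archimedean2 by blast
  then have N: "N > 0" "real n * a / \<delta> < real N" by auto
  have "\<exists>q s. 0 < q \<and> (\<forall>i<n. \<bar>of_int q * (\<kappa> * \<omega> $ e i / a) - of_int (s i)\<bar> < 1 / real N)"
    by (rule Dirichlet_approx_simult[OF N(1), where n = n and \<theta> = "\<lambda>i. \<kappa> * \<omega> $ e i / a"]) blast
  then obtain q s where q: "0 < q"
    and s: "\<And>i. i < n \<Longrightarrow> \<bar>of_int q * (\<kappa> * \<omega> $ e i / a) - of_int (s i)\<bar> < 1 / N"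
    by blast
  define z where "z = s \<circ> inv_into {0..<n} e"
  define T where "T = of_int q * \<kappa>"
  have "T \<ge> 1 * \<kappa>" unfolding T_def using q by (intro mult_right_mono) (auto simp: \<kappa>_def)
  then have "T \<ge> K" by (simp add: \<kappa>_def)
  moreover have "norm (T *\<^sub>R \<omega> - (\<chi> i. a * of_int (z i))) < \<delta>"
  proof -
    have comp: "\<bar>(T *\<^sub>R \<omega> - (\<chi> i. a * of_int (z i))) $ i\<bar> \<le> a / N" for i
    proof -
      define j where "j = inv_into {0..<n} e i"
      have j: "j < n" "e j = i"
        using e bij_betw_inv_into_right[OF e, of i] inv_into_into[of i e "{0..<n}"]
        by (auto simp: j_def bij_betw_def)
      have "(T *\<^sub>R \<omega> - (\<chi> i. a * of_int (z i))) $ i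
          = a * (of_int q * (\<kappa> * \<omega> $ e j / a) - of_int (s j))"
        using \<open>a > 0\<close> j by (simp add: T_def z_def j_def[symmetric] field_simps)
      then show ?thesis using s[OF j(1)] \<open>a > 0\<close> by (simp add: abs_mult divide_inverse less_imp_le)
    qed
    have "norm (T *\<^sub>R \<omega> - (\<chi> i. a * of_int (z i))) \<le> (\<Sum>i\<in>(UNIV :: 'd set). a / N)"
      by (rule order_trans[OF norm_le_l1_cart sum_mono]) (rule comp)
    also have "\<dots> < \<delta>" using N assms by (simp add: n_def[symmetric] field_simps)
    finally show ?thesis .
  qed
  ultimately show thesis by (rule that)
qed

text \<open>At a late return time the value is small by the limit, and close to the starting value by continuity at
one point of the torus.\<close>

lemma quasi_periodic_tendsto_0:
  fixes Z :: "real ^ 'd \<Rightarrow> real"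
  assumes cont: "continuous_on UNIV Z" and per: "\<And>\<psi> i. Z (\<psi> + axis i (2 * pi)) = Z \<psi>"
    and lim: "((\<lambda>t. Z (t *\<^sub>R \<omega>)) \<longlongrightarrow> 0) at_top"
  shows "Z (t *\<^sub>R \<omega>) = 0"
proof (rule ccontr)
  assume "Z (t *\<^sub>R \<omega>) \<noteq> 0"
  define e where "e = \<bar>Z (t *\<^sub>R \<omega>)\<bar> / 2"
  have e: "e > 0" using \<open>Z (t *\<^sub>R \<omega>) \<noteq> 0\<close> by (simp add: e_def)
  obtain \<delta> where \<delta>: "\<delta> > 0" "\<And>y. dist y (t *\<^sub>R \<omega>) < \<delta> \<Longrightarrow> dist (Z y) (Z (t *\<^sub>R \<omega>)) < e"
    using cont e unfolding continuous_on_iff by (metis UNIV_I)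
  obtain K where K: "\<And>s. s \<ge> K \<Longrightarrow> \<bar>Z (s *\<^sub>R \<omega>)\<bar> < e"
    using tendstoD[OF lim e] by (auto simp: eventually_at_top_linorder)
  obtain T and z :: "'d \<Rightarrow> int" where T: "T \<ge> K - t"
    "norm (T *\<^sub>R \<omega> - (\<chi> i. 2 * pi * of_int (z i))) < \<delta>"
    using linear_flow_recurrent[OF \<delta>(1), of "2 * pi" "K - t" \<omega>] by auto
  define y where "y = (t + T) *\<^sub>R \<omega> - (\<chi> i. 2 * pi * of_int (z i))"
  have "Z (y + (\<chi> i. 2 * pi * of_int (z i))) = Z y" using per by (rule lattice_periodic)
  then have "Z y = Z ((t + T) *\<^sub>R \<omega>)" by (simp add: y_def)
  then have "\<bar>Z y\<bar> < e" using K[of "t + T"] T(1) by simp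
  moreover have "dist (Z y) (Z (t *\<^sub>R \<omega>)) < e"
    using T(2) by (intro \<delta>(2)) (simp add: y_def dist_norm algebra_simps)
  ultimately show False unfolding e_def dist_real_def by linarith
qed

lemma quasi_periodic_attractor_unique:
  assumes x0: "quasi_periodic \<omega> x0" and attr: "global_attractor p \<gamma> f \<omega> x0"
    and y: "quasi_periodic_solution p \<gamma> f \<omega> y"
  shows "y = x0"
proof -
  have "solution_on {0<..} p \<gamma> f \<omega> y"
    using y by (auto simp: quasi_periodic_solution_def solution_on_def)
  then have lim: "((\<lambda>t. (y t - x0 t, deriv y t - deriv x0 t)) \<longlongrightarrow> (0, 0)) at_top"
    using attr by (simp add: global_attractor_def)
  have lim: "((\<lambda>t. y t - x0 t) \<longlongrightarrow> 0) at_top"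
    using tendsto_fst[OF lim] by simp
  obtain X where X: "continuous_on UNIV X" "\<And>\<psi> i. X (\<psi> + axis i (2 * pi)) = X \<psi>" "\<And>t. x0 t = X (t *\<^sub>R \<omega>)"
    using x0 by (auto simp: quasi_periodic_def)
  obtain Y where Y: "continuous_on UNIV Y" "\<And>\<psi> i. Y (\<psi> + axis i (2 * pi)) = Y \<psi>" "\<And>t. y t = Y (t *\<^sub>R \<omega>)"
    using y by (auto simp: quasi_periodic_solution_def quasi_periodic_def)
  have "Y (t *\<^sub>R \<omega>) - X (t *\<^sub>R \<omega>) = 0" for t
    using lim X(1) Y(1) unfolding X(3) Y(3)
    by (intro quasi_periodic_tendsto_0[where Z = "\<lambda>\<psi>. Y \<psi> - X \<psi>"]) (auto simp: X(2) Y(2) intro!: continuous_intros)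
  then show ?thesis by (auto simp: X(3) Y(3))
qed

theorem theorem3:
  fixes f :: "real ^ 'd \<Rightarrow> real" and f_hat :: "int ^ 'd \<Rightarrow> complex"
    and \<omega> :: "real ^ 'd" and C0 \<tau> :: real and p :: nat
  assumes "C0 > 0" and "\<tau> > real CARD('d) - 1"
    and "diophantine C0 \<tau> \<omega>"
    and "analytic_fourier f f_hat"
    and "f_hat 0 \<noteq> 0"
  shows "\<exists>\<gamma>0>0. \<forall>\<gamma>>\<gamma>0. \<exists>x0.
    quasi_periodic_solution p \<gamma> f \<omega> x0 \<and>
    (\<forall>y. quasi_periodic_solution p \<gamma> f \<omega> y \<longrightarrow> y = x0) \<and>
    global_attractor p \<gamma> f \<omega> x0"
proof -
  have series: "\<And>\<psi>. ((\<lambda>\<nu>. exp (\<i> * complex_of_real (idx_dot \<psi> \<nu>)) * f_hat \<nu>) has_sum complex_of_real (f \<psi>)) UNIV"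
    using assms(4) by (simp add: analytic_fourier_def)
  have nonres: "\<forall>\<nu>. \<nu> \<noteq> 0 \<longrightarrow> idx_dot \<omega> \<nu> \<noteq> 0"
    using diophantine_nonresonant[OF assms(1,3)] by blast
  define a where "a = root (2 * p + 1) (Re (f_hat 0))"
  have mean: "a ^ (2 * p + 1) = Re (f_hat 0)"
    unfolding a_def by (rule odd_real_root_pow) simp
  have "Re (f_hat 0) \<noteq> 0"
    using Fourier_mean_real[OF series nonres] assms(5) by (simp add: complex_eq_iff)
  with mean have a: "a \<noteq> 0" by auto
  have "\<forall>\<^sub>F \<gamma> in at_top. \<exists>X x'. X \<in> bcontfun \<and>
    (\<forall>\<psi>. \<forall>v\<in>range (\<lambda>i. axis i (2 * pi)). X (\<psi> + v) = X \<psi>) \<and>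
    (\<forall>\<psi>. \<bar>a\<bar> / 2 \<le> \<bar>X \<psi>\<bar>) \<and>
    (\<forall>t. ((\<lambda>t. X (t *\<^sub>R \<omega>)) has_real_derivative x' t) (at t)) \<and>
    (\<forall>t. (x' has_real_derivative f (t *\<^sub>R \<omega>) - \<gamma> * x' t - X (t *\<^sub>R \<omega>) ^ (2 * p + 1)) (at t)) \<and>
    (\<forall>t. 8 * real (2 * p + 1) ^ 2 * \<bar>x' t\<bar> \<le> \<gamma> * (\<bar>a\<bar> / 2))"
  proof (rule eventually_bounded_response[OF a Fourier_sum_bcontfun[OF series nonres]])
    show "\<forall>\<psi>. \<forall>v\<in>range (\<lambda>i. axis i (2 * pi)). f (\<psi> + v) = f \<psi>"
      using Fourier_sum_periodic[OF series] by auto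
  qed (unfold mean, intro allI impI real_flow_primitive[OF series nonres])
  then obtain \<gamma>1 where \<gamma>1: "\<And>\<gamma>. \<gamma> \<ge> \<gamma>1 \<Longrightarrow> \<exists>X x'. X \<in> bcontfun \<and>
    (\<forall>\<psi>. \<forall>v\<in>range (\<lambda>i. axis i (2 * pi)). X (\<psi> + v) = X \<psi>) \<and>
    (\<forall>\<psi>. \<bar>a\<bar> / 2 \<le> \<bar>X \<psi>\<bar>) \<and>
    (\<forall>t. ((\<lambda>t. X (t *\<^sub>R \<omega>)) has_real_derivative x' t) (at t)) \<and>
    (\<forall>t. (x' has_real_derivative f (t *\<^sub>R \<omega>) - \<gamma> * x' t - X (t *\<^sub>R \<omega>) ^ (2 * p + 1)) (at t)) \<and>
    (\<forall>t. 8 * real (2 * p + 1) ^ 2 * \<bar>x' t\<bar> \<le> \<gamma> * (\<bar>a\<bar> / 2))"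
    unfolding eventually_at_top_linorder by blast
  show ?thesis
  proof (intro exI[of _ "max \<gamma>1 1"] conjI allI impI)
    fix \<gamma> :: real assume "max \<gamma>1 1 < \<gamma>"
    then have \<gamma>: "\<gamma>1 \<le> \<gamma>" "0 < \<gamma>" by auto
    obtain X x' where X: "X \<in> bcontfun" "\<And>\<psi> i. X (\<psi> + axis i (2 * pi)) = X \<psi>"
      and lower: "\<And>\<psi>. \<bar>a\<bar> / 2 \<le> \<bar>X \<psi>\<bar>"
      and dX: "\<And>t. ((\<lambda>t. X (t *\<^sub>R \<omega>)) has_real_derivative x' t) (at t)"
      and dx': "\<And>t. (x' has_real_derivative f (t *\<^sub>R \<omega>) - \<gamma> * x' t - X (t *\<^sub>R \<omega>) ^ (2 * p + 1)) (at t)"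
      and slow: "\<And>t. 8 * real (2 * p + 1) ^ 2 * \<bar>x' t\<bar> \<le> \<gamma> * (\<bar>a\<bar> / 2)"
      using \<gamma>1[OF \<gamma>(1)] by blast
    define x0 where "x0 t = X (t *\<^sub>R \<omega>)" for t
    have sol: "solution_on UNIV p \<gamma> f \<omega> x0" and x': "deriv x0 = x'"
      using solution_onI[of x0 x' f \<omega> \<gamma> p] dX dx' by (simp_all add: x0_def[abs_def])
    have qp: "quasi_periodic \<omega> x0"
      using X by (auto simp: quasi_periodic_def x0_def real_bcontfun_iff)
    have attr: "global_attractor p \<gamma> f \<omega> x0"
      by (rule slow_solution_global_attractor[OF \<gamma>(2) _ sol, of "\<bar>a\<bar> / 2"])
        (use a lower slow in \<open>auto simp: x' x0_def\<close>)
    show "\<exists>x0. quasi_periodic_solution p \<gamma> f \<omega> x0 \<and>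
        (\<forall>y. quasi_periodic_solution p \<gamma> f \<omega> y \<longrightarrow> y = x0) \<and> global_attractor p \<gamma> f \<omega> x0"
    proof (intro exI conjI allI impI)
      show "quasi_periodic_solution p \<gamma> f \<omega> x0"
        unfolding quasi_periodic_solution_def using sol qp by (rule conjI)
      show "y = x0" if "quasi_periodic_solution p \<gamma> f \<omega> y" for y
        using qp attr that by (rule quasi_periodic_attractor_unique)
    qed (rule attr)
  qed simp
qed

end
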